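(* Let $F$ be a free group of rank $k\ge 2$, let $\mathcal M=CV(F)/Out(F)$ be the moduli space of volume-one metric graphs with fundamental group $F$, and let $\overline h:\mathcal M\to\mathbb{R}$ be the volume entropy function. Then: (1) $\min_{\mathcal M}\overline h=(3k-3)\log 2$. This minimum is realized by any regular trivalent connected graph $\Gamma$ with $\pi_1(\Gamma)\cong F$ (so that $\Gamma$ has $3k-3$ non-oriented edges), where each edge of $\Gamma$ is given length $1/(3k-3)$. (2) If a point of $\mathcal M$ realizes the minimum of $\overline h$, then this point is a regular trivalent graph with all edges of equal lengths. (3) $\sup_{\mathcal M}\overline h=\infty$.
   Context: Graphs may have loops and multiple edges; $E\Gamma$ is the set of oriented edges of $\Gamma$, and $e^{-1}$ is the inverse of $e\in E\Gamma$. A metric structure $\mathcal L$ on a finite graph $\Gamma$ assigns to each $e\in E\Gamma$ a length $L(e)=L(e^{-1})>0$; its volume is $\frac12\sum_{e\in E\Gamma}L(e)$ (each non-oriented edge is counted once). A point of $\mathcal M=CV(F)/Out(F)$ is (an isometry class of) a pair $(\Gamma,\mathcal L)$, where $\Gamma$ is a finite connected graph without vertices of degree one or two and with $\pi_1(\Gamma)\cong F$, and $\mathcal L$ is a volume-one metric structure on $\Gamma$. The value $\overline h(\Gamma,\mathcal L)$ is the volume entropy of the universal cover $X=\widetilde\Gamma$ with the lifted metric $d$: $$\overline h(\Gamma,\mathcal L)=\lim_{R\to\infty}\frac1R\log\#\{g\in\pi_1(\Gamma): d(x,gx)\le R\},$$ which does not depend on $x\in X$; it equals the critical exponent of the Poincar\'e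 series $\sum_{g\in\pi_1(\Gamma)}e^{-sd(x,gx)}$. "Trivalent" means that every vertex has degree $3$. *)

theory Defs
  imports
    "HOL-Analysis.Analysis"
    "HOL-Algebra.Group"
    "HOL-Library.Infinite_Typeclass"
    "Graph_Theory.Graph_Theory"
begin

section \<open>Words and cancellation\<close>

text \<open>
  Words over an alphabet on which an involution \<open>bar\<close> (formal inverse) is given.  A word is
  reduced if it contains no letter followed by its inverse.
\<close>

fun reduce :: "('a \<Rightarrow> 'a) \<Rightarrow> 'a list \<Rightarrow> 'a list" where
  "reduce bar [] = []"
| "reduce bar (a # w) =
     (case reduce bar w of
        [] \<Rightarrow> [a]
      | b # u \<Rightarrow> if b = bar a then u else a # b # u)"

definition reduced :: "('a \<Rightarrow> 'a) \<Rightarrow> 'a list \<Rightarrow> bool" where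
  "reduced bar w \<longleftrightarrow> successively (\<lambda>a b. b \<noteq> bar a) w"

text \<open>
  Homotopy of edge walks: the equivalence relation generated by inserting or deleting a
  backtracking.  Lemma \<open>homotopic_iff_reduce\<close> shows that every homotopy class has exactly one
  reduced representative, which \<open>reduce\<close> computes; below, classes are represented by it.
\<close>

inductive homotopic :: "('a \<Rightarrow> 'a) \<Rightarrow> 'a list \<Rightarrow> 'a list \<Rightarrow> bool" for bar where
  backtrack: "homotopic bar (p @ [a, bar a] @ q) (p @ q)"
| refl: "homotopic bar p p"
| sym: "homotopic bar p q \<Longrightarrow> homotopic bar q p"
| trans: "homotopic bar p q \<Longrightarrow> homotopic bar q r \<Longrightarrow> homotopic bar p r"

lemma reduced_reduce: "reduced bar (reduce bar w)"
  by (induction w) (auto simp: reduced_def successively_Cons split: list.splits)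

lemma reduce_reduced: "reduced bar w \<Longrightarrow> reduce bar w = w"
  by (induction w) (auto simp: reduced_def successively_Cons split: list.splits)

lemma reduce_Cons_Cons:
  assumes "bar (bar a) = a"
  shows "reduce bar (a # bar a # w) = reduce bar w"
  using assms reduced_reduce[of bar w]
  by (auto simp: reduced_def successively_Cons split: list.splits)

lemma reduce_append_cong:
  "reduce bar q = reduce bar q' \<Longrightarrow> reduce bar (p @ q) = reduce bar (p @ q')"
  by (induction p) auto

lemma homotopic_Cons: "homotopic bar p q \<Longrightarrow> homotopic bar (a # p) (a # q)"
proof (induction rule: homotopic.induct)
  case (backtrack p b q)
  show ?case using homotopic.backtrack[of bar "a # p" b q] by simp
qed (auto intro: homotopic.intros)

lemma homotopic_reduce: "homotopic bar w (reduce bar w)"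
proof (induction w)
  case Nil
  show ?case by (simp add: homotopic.refl)
next
  case (Cons a w)
  have "homotopic bar (a # reduce bar w) (reduce bar (a # w))"
    using homotopic.backtrack[of bar "[]" a]
    by (auto intro: homotopic.refl split: list.splits)
  with homotopic_Cons[OF Cons.IH] show ?case
    by (blast intro: homotopic.trans)
qed

lemma homotopic_iff_reduce:
  assumes "\<And>a. bar (bar a) = a"
  shows "homotopic bar p q \<longleftrightarrow> reduce bar p = reduce bar q"
proof
  show "homotopic bar p q \<Longrightarrow> reduce bar p = reduce bar q"
  proof (induction rule: homotopic.induct)
    case (backtrack p a q)
    have "reduce bar ([a, bar a] @ q) = reduce bar q"
      using reduce_Cons_Cons[of bar a q] assms by simp
    then show ?case by (rule reduce_append_cong)
  qed auto
  show "reduce bar p = reduce bar q \<Longrightarrow> homotopic bar p q"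
    by (metis homotopic_reduce homotopic.sym homotopic.trans)
qed


section \<open>Free groups of finite rank\<close>

text \<open>A letter \<open>(b, s)\<close> stands for the generator \<open>b\<close> if \<open>s\<close> holds and for its inverse otherwise.\<close>

definition letter_inv :: "'f \<times> bool \<Rightarrow> 'f \<times> bool" where
  "letter_inv = (\<lambda>(b, s). (b, \<not> s))"

definition word_value :: "('f, 'm) monoid_scheme \<Rightarrow> ('f \<times> bool) list \<Rightarrow> 'f" where
  "word_value F w =
     foldr (\<lambda>(b, s) g. (if s then b else inv\<^bsub>F\<^esub> b) \<otimes>\<^bsub>F\<^esub> g) w \<one>\<^bsub>F\<^esub>"

definition free_basis :: "('f, 'm) monoid_scheme \<Rightarrow> 'f set \<Rightarrow> bool" where
  "free_basis F B \<longleftrightarrow> B \<subseteq> carrier F \<and>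
     bij_betw (word_value F) {w. set w \<subseteq> B \<times> UNIV \<and> reduced letter_inv w} (carrier F)"

definition free_group_of_rank :: "('f, 'm) monoid_scheme \<Rightarrow> nat \<Rightarrow> bool" where
  "free_group_of_rank F k \<longleftrightarrow>
     group F \<and> (\<exists>B. finite B \<and> card B = k \<and> free_basis F B)"


section \<open>Fundamental group and universal cover\<close>

text \<open>
  A graph is a directed multigraph \<open>G\<close> whose arcs are the oriented edges, together with the
  fixed-point free involution \<open>arev\<close> on its arcs sending an oriented edge to its inverse
  (locale \<open>bidirected_digraph\<close>).  A loop consists of two arcs, so that \<open>out_degree\<close> counts it
  twice, as it should.
\<close>

definition fundamental_group ::
    "('v, 'e) pre_digraph \<Rightarrow> ('e \<Rightarrow> 'e) \<Rightarrow> 'v \<Rightarrow> 'e list monoid" where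
  "fundamental_group G arev v =
     \<lparr>carrier = {p. pre_digraph.awalk G v p v \<and> reduced arev p},
      mult = (\<lambda>p q. reduce arev (p @ q)),
      one = []\<rparr>"

text \<open>
  The vertices of the universal cover based at \<open>v\<close> are the homotopy classes of walks starting at
  \<open>v\<close>; the arc \<open>(p, a)\<close> is the lift of \<open>a\<close> starting at \<open>p\<close>.
\<close>

definition universal_cover ::
    "('v, 'e) pre_digraph \<Rightarrow> ('e \<Rightarrow> 'e) \<Rightarrow> 'v \<Rightarrow> ('e list, 'e list \<times> 'e) pre_digraph" where
  "universal_cover G arev v =
     \<lparr>verts = {p. (\<exists>u. pre_digraph.awalk G v p u) \<and> reduced arev p},
      arcs = {(p, a). pre_digraph.awalk G v p (tail G a) \<and> reduced arev p \<and> a \<in> arcs G},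
      tail = fst,
      head = (\<lambda>(p, a). reduce arev (p @ [a]))\<rparr>"

definition deck_action :: "('e \<Rightarrow> 'e) \<Rightarrow> 'e list \<Rightarrow> 'e list \<Rightarrow> 'e list" where
  "deck_action arev g x = reduce arev (g @ x)"

text \<open>The lifted path metric: the infimum of the lengths of the walks from \<open>x\<close> to \<open>y\<close> in the cover.\<close>

definition cover_dist ::
    "('v, 'e) pre_digraph \<Rightarrow> ('e \<Rightarrow> 'e) \<Rightarrow> ('e \<Rightarrow> real) \<Rightarrow> 'v \<Rightarrow> 'e list \<Rightarrow> 'e list \<Rightarrow> ereal" where
  "cover_dist G arev L v = wf_digraph.\<mu> (universal_cover G arev v) (\<lambda>(p, a). L a)"


section \<open>Metric graphs, volume entropy, moduli space\<close>

type_synonym ('v, 'e) metric_graph =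
  "('v, 'e) pre_digraph \<times> ('e \<Rightarrow> 'e) \<times> ('e \<Rightarrow> real)"

definition finite_connected_graph :: "('v, 'e) pre_digraph \<Rightarrow> ('e \<Rightarrow> 'e) \<Rightarrow> bool" where
  "finite_connected_graph G arev \<longleftrightarrow>
     fin_digraph G \<and> bidirected_digraph G arev \<and> Digraph_Component.connected G"

definition trivalent :: "('v, 'e) pre_digraph \<Rightarrow> bool" where
  "trivalent G \<longleftrightarrow> (\<forall>v\<in>verts G. out_degree G v = 3)"

definition nonoriented_edges :: "('v, 'e) pre_digraph \<Rightarrow> ('e \<Rightarrow> 'e) \<Rightarrow> 'e set set" where
  "nonoriented_edges G arev = (\<lambda>a. {a, arev a}) ` arcs G"

definition metric_structure ::
    "('v, 'e) pre_digraph \<Rightarrow> ('e \<Rightarrow> 'e) \<Rightarrow> ('e \<Rightarrow> real) \<Rightarrow> bool" where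
  "metric_structure G arev L \<longleftrightarrow> (\<forall>a\<in>arcs G. L a > 0 \<and> L (arev a) = L a)"

definition volume :: "('v, 'e) pre_digraph \<Rightarrow> ('e \<Rightarrow> real) \<Rightarrow> real" where
  "volume G L = (1 / 2) * (\<Sum>a\<in>arcs G. L a)"

definition has_fundamental_group ::
    "('v, 'e) pre_digraph \<Rightarrow> ('e \<Rightarrow> 'e) \<Rightarrow> ('f, 'm) monoid_scheme \<Rightarrow> bool" where
  "has_fundamental_group G arev F \<longleftrightarrow> (\<forall>v\<in>verts G. fundamental_group G arev v \<cong> F)"

text \<open>
  The entropy is the common value of the limits for all base vertices \<open>v\<close> of the graph and all
  vertices \<open>x\<close> of the universal cover.
\<close>

definition volume_entropy :: "('v, 'e) metric_graph \<Rightarrow> real" where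
  "volume_entropy = (\<lambda>(G, arev, L).
     (THE h. \<forall>v\<in>verts G. \<forall>x\<in>verts (universal_cover G arev v).
        ((\<lambda>R::real. ln (real (card {g \<in> carrier (fundamental_group G arev v).
             cover_dist G arev L v x (deck_action arev g x) \<le> ereal R})) / R) \<longlongrightarrow> h) at_top))"

text \<open>
  The points of \<open>CV(F)/Out(F)\<close>, each given by all the metric graphs (with vertices and edges from
  the types \<open>'v\<close>, \<open>'e\<close>) in its isometry class.
\<close>

definition moduli_space :: "('f, 'm) monoid_scheme \<Rightarrow> ('v, 'e) metric_graph set" where
  "moduli_space F = {(G, arev, L).
     finite_connected_graph G arev \<and>
     (\<forall>v\<in>verts G. out_degree G v \<noteq> 1 \<and> out_degree G v \<noteq> 2) \<and>
     has_fundamental_group G arev F \<and>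
     metric_structure G arev L \<and>
     volume G L = 1}"

end

theory Submission
  imports Defs
begin

text \<open>
  The volume entropy of a metric graph counts closed reduced walks, and reduced walks are the
  paths of a finite transition system on the oriented edges: from \<open>a\<close> one may turn into every
  \<open>b \<noteq> arev a\<close> that starts where \<open>a\<close> ends.  Weighting a step into \<open>b\<close> by \<open>exp (- h * L b)\<close> turns
  the entropy into an eigenvalue problem: \<open>h\<close> is the entropy as soon as some positive function
  \<open>x\<close> on the oriented edges satisfies
  \<open>x a = (\<Sum>b\<in>turns a. exp (- h * L b) * x b)\<close> for all \<open>a\<close>.
  Iterating this equation shows that the number of continuations of length at most \<open>R\<close> is
  \<open>exp (h * R)\<close> up to a linear factor (lemmas \<open>card_short_continuations_le\<close> and
  \<open>card_short_continuations_ge\<close>).  Together with the description of distances in the universal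
  cover this gives both the existence of the limit and its value (\<open>volume_entropy_eqI\<close>).  A
  solution exists for the smallest \<open>h\<close> that admits a positive \<open>x\<close> with \<open>\<ge>\<close> in place of \<open>=\<close>
  (\<open>ex_harmonic_critical\<close>).

  For the lower bound, concavity of the logarithm is applied to each of these equations, and the
  results are averaged over all oriented edges.  Because the walk that chooses each turn with
  equal probability preserves the uniform distribution, the terms with \<open>ln (x a)\<close> cancel, and
  what remains for volume one is
  \<open>2 * h \<ge> (\<Sum>v. d v * ln (d v - 1))\<close>, where \<open>d v\<close> is the degree of \<open>v\<close> (\<open>harmonic_log_average\<close>).
  The numerical inequality \<open>d * ln (d - 1) \<ge> 3 * (d - 2) * ln 2\<close> for \<open>d \<ge> 3\<close>, strict unless
  \<open>d = 3\<close>, and the Euler characteristic, which gives \<open>(\<Sum>v. d v - 2) = 2 * k - 2\<close>, yield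
  \<open>h \<ge> (3 * k - 3) * ln 2\<close>.  In the equality case all degrees are \<open>3\<close> and all summands on the
  right of each equation agree; comparing the equations of an oriented edge and of its inverse
  then gives \<open>exp (h * L a) = 2\<close> for every \<open>a\<close>.  Conversely, on a trivalent graph with constant
  length the constant function \<open>x = 1\<close> solves the equations.

  The number \<open>k\<close> enters only through the Euler characteristic: a spanning tree exhibits the
  fundamental group as free on the remaining edges, and the rank of a free group is an invariant
  (\<open>has_fundamental_group_iff\<close>).  This also shows that the explicit examples have the right
  fundamental group: a trivalent necklace for the minimum, and a rose one petal of which has
  length \<open>\<epsilon>\<close>, whose entropy satisfies \<open>h * \<epsilon> \<ge> exp (- h)\<close> and hence is unbounded as
  \<open>\<epsilon>\<close> tends to \<open>0\<close>.
\<close>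

section \<open>Cancellation in words\<close>

lemma set_reduce: "set (reduce bar w) \<subseteq> set w"
  by (induction w) (auto split: list.splits if_splits)

lemma sum_list_reduce_le:
  fixes L :: "'a \<Rightarrow> real"
  assumes "\<And>a. a \<in> set w \<Longrightarrow> 0 \<le> L a"
  shows "sum_list (map L (reduce bar w)) \<le> sum_list (map L w)"
  using assms
proof (induction w)
  case (Cons a w)
  then have IH: "sum_list (map L (reduce bar w)) \<le> sum_list (map L w)" by simp
  have a: "0 \<le> L a" using Cons.prems by simp
  show ?case
  proof (cases "reduce bar w")
    case Nil
    with IH a show ?thesis by simp
  next
    case (Cons b u)
    have "b \<in> set (a # w)" using set_reduce[of bar w] Cons by auto
    then have "0 \<le> L b" using Cons.prems by blast
    with IH a Cons show ?thesis by auto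
  qed
qed simp

lemma reduced_simps [simp]: "reduced bar []" "reduced bar [a]"
  by (simp_all add: reduced_def)

locale involution =
  fixes bar :: "'a \<Rightarrow> 'a"
  assumes bar_bar [simp]: "bar (bar a) = a"
begin

definition word_inv :: "'a list \<Rightarrow> 'a list" where
  "word_inv w = rev (map bar w)"

lemma word_inv_simps [simp]:
  "word_inv [] = []" "word_inv (a # w) = word_inv w @ [bar a]"
  "word_inv (v @ w) = word_inv w @ word_inv v" "word_inv (word_inv w) = w"
  by (simp_all add: word_inv_def rev_map o_def)

lemma bar_eq_iff [simp]: "bar a = bar b \<longleftrightarrow> a = b"
  by (metis bar_bar)

lemma set_word_inv [simp]: "set (word_inv w) = bar ` set w"
  by (simp add: word_inv_def)

lemma homotopic_iff: "homotopic bar p q \<longleftrightarrow> reduce bar p = reduce bar q"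
  by (rule homotopic_iff_reduce) simp

lemma homotopic_append: "homotopic bar p q \<Longrightarrow> homotopic bar (p @ r) (q @ r)"
proof (induction rule: homotopic.induct)
  case (backtrack p a q)
  show ?case using homotopic.backtrack[of bar p a "q @ r"] by simp
qed (auto intro: homotopic.intros)

lemma reduce_append_left [simp]: "reduce bar (reduce bar p @ q) = reduce bar (p @ q)"
  using homotopic_append[OF homotopic_reduce[of bar p]] homotopic_iff by metis

lemma reduce_append_right [simp]: "reduce bar (p @ reduce bar q) = reduce bar (p @ q)"
  by (rule reduce_append_cong) (simp add: reduce_reduced reduced_reduce)

lemma reduce_idem [simp]: "reduce bar (reduce bar p) = reduce bar p"
  by (simp add: reduce_reduced reduced_reduce)

lemma reduce_append_cong2:
  "reduce bar p = reduce bar p' \<Longrightarrow> reduce bar q = reduce bar q' \<Longrightarrow>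
    reduce bar (p @ q) = reduce bar (p' @ q')"
  by (metis reduce_append_left reduce_append_right)

lemma reduce_cancel_right: "reduce bar (p @ word_inv p @ q) = reduce bar q"
proof (induction p arbitrary: q)
  case (Cons a p)
  have "reduce bar ((a # p) @ word_inv (a # p) @ q) = reduce bar ([a] @ (p @ word_inv p @ [bar a] @ q))"
    by simp
  also have "\<dots> = reduce bar ([a] @ [bar a] @ q)"
    using Cons.IH reduce_append_cong by blast
  also have "\<dots> = reduce bar q"
    using reduce_Cons_Cons[of bar a q] by simp
  finally show ?case .
qed simp

lemma reduce_cancel_left: "reduce bar (word_inv p @ p @ q) = reduce bar q"
  using reduce_cancel_right[of "word_inv p"] by simp

lemma reduce_append_cancel:
  "reduce bar (p @ q) = reduce bar (p @ r) \<longleftrightarrow> reduce bar q = reduce bar r"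
proof
  assume "reduce bar (p @ q) = reduce bar (p @ r)"
  then have "reduce bar (word_inv p @ p @ q) = reduce bar (word_inv p @ p @ r)"
    by (rule reduce_append_cong)
  then show "reduce bar q = reduce bar r" by (simp add: reduce_cancel_left)
qed (rule reduce_append_cong)

lemma reduced_word_inv: "reduced bar w \<Longrightarrow> reduced bar (word_inv w)"
  unfolding reduced_def word_inv_def
  by (auto simp: successively_rev successively_map elim!: successively_mono)

lemma reduce_word_inv: "reduce bar (word_inv p) = word_inv (reduce bar p)"
proof -
  have "reduce bar (reduce bar p @ word_inv (reduce bar p)) = reduce bar (p @ word_inv p)"
    using reduce_cancel_right[of _ "[]"] by (metis append_Nil2)
  then have "reduce bar (word_inv (reduce bar p)) = reduce bar (word_inv p)"
    by (simp add: reduce_append_cancel)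
  then show ?thesis
    by (simp add: reduce_reduced reduced_word_inv reduced_reduce)
qed

text \<open>
  Deleting all letters of a set that is closed under inverses is compatible with cancellation,
  since it sends a backtracking to a backtracking or to nothing.  This is how walks are compared
  with their parts outside a spanning tree.
\<close>

lemma reduce_filter_reduce:
  assumes "\<And>a. P (bar a) \<longleftrightarrow> P a"
  shows "reduce bar (filter P (reduce bar w)) = reduce bar (filter P w)"
proof -
  have "homotopic bar p q \<Longrightarrow> homotopic bar (filter P p) (filter P q)" for p q
  proof (induction rule: homotopic.induct)
    case (backtrack p a q)
    show ?case
      using homotopic.backtrack[of bar "filter P p" a "filter P q"] assms[of a]
      by (auto intro: homotopic.refl)
  qed (auto intro: homotopic.intros)
  from this[OF homotopic_reduce[of bar w]] show ?thesis
    by (simp add: homotopic_iff)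
qed

end

section \<open>Free groups\<close>

interpretation letters: involution letter_inv
  by unfold_locales (auto simp: letter_inv_def)

lemma letter_inv_simps [simp]: "fst (letter_inv a) = fst a" "letter_inv (b, s) = (b, \<not> s)"
  by (auto simp: letter_inv_def split: prod.splits)

abbreviation letter_value :: "('f, 'm) monoid_scheme \<Rightarrow> 'f \<times> bool \<Rightarrow> 'f" where
  "letter_value F a \<equiv> (if snd a then fst a else inv\<^bsub>F\<^esub> (fst a))"

lemma word_value_simps [simp]:
  "word_value F [] = \<one>\<^bsub>F\<^esub>"
  "word_value F (a # w) = letter_value F a \<otimes>\<^bsub>F\<^esub> word_value F w"
  by (simp_all add: word_value_def case_prod_unfold)

context group
begin

lemma word_value_closed:
  "fst ` set w \<subseteq> carrier G \<Longrightarrow> word_value G w \<in> carrier G"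
  by (induction w) auto

lemma word_value_append:
  "fst ` set v \<subseteq> carrier G \<Longrightarrow> fst ` set w \<subseteq> carrier G \<Longrightarrow>
    word_value G (v @ w) = word_value G v \<otimes> word_value G w"
  by (induction v) (auto simp: m_assoc word_value_closed)

text \<open>
  This is what makes the product of two reduced words computable by cancellation, and hence
  the reason why a group with a free basis is determined by the size of this basis.
\<close>

lemma word_value_reduce:
  "fst ` set w \<subseteq> carrier G \<Longrightarrow> word_value G (reduce letter_inv w) = word_value G w"
proof (induction w)
  case (Cons a w)
  then have IH: "word_value G (reduce letter_inv w) = word_value G w"
    and a: "fst a \<in> carrier G" and w: "fst ` set w \<subseteq> carrier G" by auto
  show ?case
  proof (cases "reduce letter_inv w")
    case Nil
    with IH show ?thesis by simp
  next
    case (Cons b u)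
    have u: "fst ` set u \<subseteq> carrier G"
      using w set_reduce[of letter_inv w] Cons by auto
    show ?thesis
    proof (cases "b = letter_inv a")
      case True
      have "word_value G (a # w) = letter_value G a \<otimes> (letter_value G b \<otimes> word_value G u)"
        using IH Cons by simp
      also have "\<dots> = word_value G u"
        using a u word_value_closed[OF u] True
        by (cases a) (auto simp: m_assoc[symmetric])
      finally show ?thesis using True Cons by simp
    qed (use IH Cons in simp)
  qed
qed simp

end

lemma free_basis_surj:
  assumes "free_basis F B" and "g \<in> carrier F"
  obtains w where "set w \<subseteq> B \<times> UNIV" "reduced letter_inv w" "word_value F w = g"
proof -
  have "g \<in> word_value F ` {w. set w \<subseteq> B \<times> UNIV \<and> reduced letter_inv w}"
    using assms unfolding free_basis_def bij_betw_def by simp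
  then show ?thesis using that by blast
qed

lemma free_basis_inj:
  assumes "free_basis F B" "set v \<subseteq> B \<times> UNIV" "reduced letter_inv v"
    "set w \<subseteq> B \<times> UNIV" "reduced letter_inv w" "word_value F v = word_value F w"
  shows "v = w"
  using assms unfolding free_basis_def bij_betw_def inj_on_def by blast

lemma free_basis_set:
  assumes "free_basis F B" "set w \<subseteq> B \<times> UNIV"
  shows "fst ` set w \<subseteq> carrier F"
  using assms unfolding free_basis_def by auto

definition basis_word :: "('f, 'm) monoid_scheme \<Rightarrow> 'f set \<Rightarrow> 'f \<Rightarrow> ('f \<times> bool) list" where
  "basis_word F B g =
     (THE w. set w \<subseteq> B \<times> UNIV \<and> reduced letter_inv w \<and> word_value F w = g)"

lemma basis_word_eqI:
  assumes "free_basis F B" "set w \<subseteq> B \<times> UNIV" "reduced letter_inv w" "word_value F w = g"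
  shows "basis_word F B g = w"
  unfolding basis_word_def using assms free_basis_inj[OF assms(1)] by (intro the_equality) auto

lemma basis_word:
  assumes "free_basis F B" "g \<in> carrier F"
  shows "set (basis_word F B g) \<subseteq> B \<times> UNIV" "reduced letter_inv (basis_word F B g)"
    "word_value F (basis_word F B g) = g"
proof -
  obtain w where w: "set w \<subseteq> B \<times> UNIV" "reduced letter_inv w" "word_value F w = g"
    using free_basis_surj[OF assms] .
  moreover have "basis_word F B g = w" using basis_word_eqI[OF assms(1) w] .
  ultimately show "set (basis_word F B g) \<subseteq> B \<times> UNIV" "reduced letter_inv (basis_word F B g)"
    "word_value F (basis_word F B g) = g" by auto
qed

lemma (in group) basis_word_mult:
  assumes B: "free_basis G B" and "g \<in> carrier G" "h \<in> carrier G"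
  shows "basis_word G B (g \<otimes> h) = reduce letter_inv (basis_word G B g @ basis_word G B h)"
proof (rule basis_word_eqI[OF B])
  note g = basis_word[OF B assms(2)] and h = basis_word[OF B assms(3)]
  show "set (reduce letter_inv (basis_word G B g @ basis_word G B h)) \<subseteq> B \<times> UNIV"
    using set_reduce[of letter_inv] g(1) h(1) by fastforce
  show "word_value G (reduce letter_inv (basis_word G B g @ basis_word G B h)) = g \<otimes> h"
    using g h free_basis_set[OF B g(1)] free_basis_set[OF B h(1)]
    by (subst word_value_reduce) (auto simp: word_value_append)
qed (rule reduced_reduce)

lemma (in group) basis_word_generator:
  assumes B: "free_basis G B" and "b \<in> B"
  shows "basis_word G B b = [(b, True)]"
proof (rule basis_word_eqI[OF B])
  have "b \<in> carrier G" using assms by (auto simp: free_basis_def)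
  then show "word_value G [(b, True)] = b" by simp
qed (use assms in \<open>auto simp: reduced_def\<close>)

text \<open>
  The homomorphisms to the group with two elements, written as \<open>bool\<close> with exclusive
  disjunction.  Such a homomorphism is an arbitrary function on a free basis, so that there are
  \<open>2 ^ n\<close> of them if the basis has \<open>n\<close> elements; this makes the rank an invariant.
\<close>

definition parity_homs :: "('f, 'm) monoid_scheme \<Rightarrow> ('f \<Rightarrow> bool) set" where
  "parity_homs F = {\<phi> \<in> carrier F \<rightarrow>\<^sub>E UNIV.
     \<forall>g\<in>carrier F. \<forall>h\<in>carrier F. \<phi> (g \<otimes>\<^bsub>F\<^esub> h) \<longleftrightarrow> (\<phi> g \<noteq> \<phi> h)}"

definition word_parity :: "('f \<Rightarrow> bool) \<Rightarrow> ('f \<times> bool) list \<Rightarrow> bool" where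
  "word_parity c w \<longleftrightarrow> odd (length (filter (c \<circ> fst) w))"

lemma word_parity_reduce: "word_parity c (reduce letter_inv w) = word_parity c w"
proof (induction w)
  case (Cons a w)
  then show ?case
    by (auto simp: word_parity_def split: list.splits)
qed simp

lemma word_parity_append: "word_parity c (v @ w) \<longleftrightarrow> (word_parity c v \<noteq> word_parity c w)"
  by (auto simp: word_parity_def)

lemma (in group) parity_hom_determined:
  assumes B: "free_basis G B" and \<phi>: "\<phi> \<in> parity_homs G" and g: "g \<in> carrier G"
  shows "\<phi> g = word_parity \<phi> (basis_word G B g)"
proof -
  have mult: "\<phi> (g \<otimes> h) \<longleftrightarrow> (\<phi> g \<noteq> \<phi> h)" if "g \<in> carrier G" "h \<in> carrier G" for g h
    using \<phi> that by (auto simp: parity_homs_def)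
  have one: "\<not> \<phi> \<one>" using mult[of \<one> \<one>] by simp
  have inv: "\<phi> (inv x) = \<phi> x" if "x \<in> carrier G" for x
    using mult[of x "inv x"] that one by auto
  have "\<phi> (word_value G w) = word_parity \<phi> w" if "fst ` set w \<subseteq> carrier G" for w
    using that
  proof (induction w)
    case (Cons a w)
    then have "\<phi> (word_value G (a # w)) \<longleftrightarrow> (\<phi> (letter_value G a) \<noteq> word_parity \<phi> w)"
      by (auto simp: mult word_value_closed)
    also have "\<phi> (letter_value G a) = \<phi> (fst a)" using inv Cons.prems by auto
    finally show ?case by (auto simp: word_parity_def)
  qed (simp add: one word_parity_def)
  from this[OF free_basis_set[OF B basis_word(1)[OF B g]]] basis_word(3)[OF B g]
  show ?thesis by simp
qed

lemma (in group) bij_betw_parity_homs: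
  assumes B: "free_basis G B"
  shows "bij_betw (\<lambda>\<phi>. restrict \<phi> B) (parity_homs G) (B \<rightarrow>\<^sub>E (UNIV :: bool set))"
proof (rule bij_betw_imageI)
  have parity_cong: "word_parity \<phi> w = word_parity \<psi> w"
    if "restrict \<phi> B = restrict \<psi> B" "set w \<subseteq> B \<times> UNIV" for \<phi> \<psi> w
  proof -
    have "\<phi> b = \<psi> b" if "b \<in> B" for b
      using fun_cong[OF \<open>restrict \<phi> B = restrict \<psi> B\<close>, of b] that by simp
    then have "filter (\<phi> \<circ> fst) w = filter (\<psi> \<circ> fst) w"
      using that(2) by (intro filter_cong refl) auto
    then show ?thesis by (simp add: word_parity_def)
  qed
  show "inj_on (\<lambda>\<phi>. restrict \<phi> B) (parity_homs G)"
  proof (rule inj_onI)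
    fix \<phi> \<psi> assume *: "\<phi> \<in> parity_homs G" "\<psi> \<in> parity_homs G" "restrict \<phi> B = restrict \<psi> B"
    have "\<phi> g = \<psi> g" if "g \<in> carrier G" for g
      using parity_hom_determined[OF B *(1) that] parity_hom_determined[OF B *(2) that]
        parity_cong[OF *(3) basis_word(1)[OF B that]] by simp
    moreover have "\<phi> \<in> carrier G \<rightarrow>\<^sub>E UNIV" "\<psi> \<in> carrier G \<rightarrow>\<^sub>E UNIV"
      using * by (auto simp: parity_homs_def)
    ultimately show "\<phi> = \<psi>" by (intro PiE_ext)
  qed
  show "(\<lambda>\<phi>. restrict \<phi> B) ` parity_homs G = B \<rightarrow>\<^sub>E UNIV"
  proof (intro equalityI subsetI)
    fix c :: "'a \<Rightarrow> bool" assume c: "c \<in> B \<rightarrow>\<^sub>E UNIV"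
    define \<phi> where "\<phi> = restrict (\<lambda>g. word_parity c (basis_word G B g)) (carrier G)"
    have "\<phi> \<in> parity_homs G"
      by (auto simp: parity_homs_def \<phi>_def basis_word_mult[OF B] word_parity_reduce
          word_parity_append)
    moreover have "restrict \<phi> B = c"
    proof
      fix b
      show "restrict \<phi> B b = c b"
        using c B basis_word_generator[OF B]
        by (cases "b \<in> B") (auto simp: \<phi>_def free_basis_def word_parity_def)
    qed
    ultimately show "c \<in> (\<lambda>\<phi>. restrict \<phi> B) ` parity_homs G" by blast
  qed auto
qed

lemma (in group) free_rank_unique:
  assumes "free_basis G B" "free_basis G C" "finite B" "finite C"
  shows "card B = card C"
proof -
  have "card (parity_homs G) = 2 ^ card D" if "free_basis G D" "finite D" for D
    using bij_betw_same_card[OF bij_betw_parity_homs[OF that(1)]] that(2)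
    by (simp add: card_PiE)
  from this[of B] this[of C] assms show ?thesis by simp
qed

lemma free_group_of_rank_unique:
  assumes "free_group_of_rank F k" "free_group_of_rank F m"
  shows "k = m"
  using assms group.free_rank_unique unfolding free_group_of_rank_def by blast

lemma reduced_map_letters:
  assumes "inj_on f B" "set w \<subseteq> B \<times> UNIV"
  shows "reduced letter_inv (map (apfst f) w) \<longleftrightarrow> reduced letter_inv w"
proof -
  have "apfst f b \<noteq> letter_inv (apfst f a) \<longleftrightarrow> b \<noteq> letter_inv a"
    if "a \<in> set w" "b \<in> set w" for a b
  proof -
    have "f (fst a) = f (fst b) \<longleftrightarrow> fst a = fst b"
      using that assms by (intro inj_on_eq_iff[OF assms(1)]) auto
    then show ?thesis by (cases a; cases b) auto
  qed
  then show ?thesis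
    unfolding reduced_def successively_map by (intro successively_cong) auto
qed

lemma free_basis_iso_image:
  assumes F: "group F" and H: "group H" and \<psi>: "\<psi> \<in> iso F H" and B: "free_basis F B"
  shows "free_basis H (\<psi> ` B)"
proof -
  interpret F: group F by fact
  interpret H: group H by fact
  interpret group_hom F H \<psi> using \<psi> by unfold_locales (auto simp: iso_def)
  have bij: "bij_betw \<psi> (carrier F) (carrier H)" using \<psi> by (simp add: iso_def)
  have BF: "B \<subseteq> carrier F" using B by (simp add: free_basis_def)
  have inj: "inj_on \<psi> B" using bij BF by (auto simp: bij_betw_def intro: inj_on_subset)
  have val: "word_value H (map (apfst \<psi>) w) = \<psi> (word_value F w)"
    if "fst ` set w \<subseteq> carrier F" for w
    using that by (induction w) (auto simp: F.word_value_closed)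
  let ?m = "map (apfst \<psi>) :: (_ \<times> bool) list \<Rightarrow> _"
  let ?W = "\<lambda>B. {w. set w \<subseteq> B \<times> (UNIV :: bool set) \<and> reduced letter_inv w}"
  have m: "bij_betw ?m (?W B) (?W (\<psi> ` B))"
  proof (rule bij_betw_byWitness[where f' = "map (apfst (inv_into B \<psi>))"])
    show "\<forall>w\<in>?W B. map (apfst (inv_into B \<psi>)) (?m w) = w"
      using inj by (auto intro!: map_idI)
    show "\<forall>w\<in>?W (\<psi> ` B). ?m (map (apfst (inv_into B \<psi>)) w) = w"
      by (auto intro!: map_idI simp: f_inv_into_f)
    have "set (?m w) \<subseteq> \<psi> ` B \<times> UNIV" if "set w \<subseteq> B \<times> UNIV" for w
      using that by fastforce
    then show "?m ` ?W B \<subseteq> ?W (\<psi> ` B)"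
      using reduced_map_letters[OF inj] by blast
    have inj': "inj_on (inv_into B \<psi>) (\<psi> ` B)" by (rule inj_on_inv_into) simp
    have "set (map (apfst (inv_into B \<psi>)) w) \<subseteq> B \<times> UNIV" if "set w \<subseteq> \<psi> ` B \<times> UNIV"
      for w :: "(_ \<times> bool) list"
    proof
      fix x assume "x \<in> set (map (apfst (inv_into B \<psi>)) w)"
      then obtain a where a: "a \<in> set w" "x = apfst (inv_into B \<psi>) a" by auto
      then have "fst a \<in> \<psi> ` B" using that by auto
      then show "x \<in> B \<times> UNIV" using inv_into_into[of "fst a" \<psi> B] a(2) by (cases a) auto
    qed
    then show "map (apfst (inv_into B \<psi>)) ` ?W (\<psi> ` B) \<subseteq> ?W B"
      using reduced_map_letters[OF inj'] by blast
  qed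
  have "bij_betw (\<psi> \<circ> word_value F) (?W B) (carrier H)"
    using B bij unfolding free_basis_def by (auto intro: bij_betw_trans)
  then have "bij_betw (word_value H \<circ> ?m) (?W B) (carrier H)"
    by (rule bij_betw_cong[THEN iffD1, rotated]) (simp add: val[OF free_basis_set[OF B]])
  then have "bij_betw (word_value H) (?W (\<psi> ` B)) (carrier H)"
    using bij_betw_comp_iff[OF m] by blast
  then show ?thesis using BF by (auto simp: free_basis_def)
qed

lemma free_group_of_rank_iso:
  assumes "free_group_of_rank F k" "group H" "F \<cong> H"
  shows "free_group_of_rank H k"
proof -
  obtain B where F: "group F" and B: "finite B" "card B = k" "free_basis F B"
    using assms(1) unfolding free_group_of_rank_def by blast
  obtain \<psi> where \<psi>: "\<psi> \<in> iso F H" using assms(3) by (auto simp: is_iso_def)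
  have "inj_on \<psi> B"
    using \<psi> B(3) unfolding iso_def bij_betw_def free_basis_def by (auto intro: inj_on_subset)
  then show ?thesis
    using free_basis_iso_image[OF F assms(2) \<psi> B(3)] B assms(2)
    unfolding free_group_of_rank_def by (auto simp: card_image intro!: exI[of _ "\<psi> ` B"])
qed

lemma reduce_map_letters:
  assumes "inj_on f B" "set w \<subseteq> B \<times> UNIV"
  shows "reduce letter_inv (map (apfst f) w) = map (apfst f) (reduce letter_inv w)"
  using assms(2)
proof (induction w)
  case (Cons a w)
  then have IH: "reduce letter_inv (map (apfst f) w) = map (apfst f) (reduce letter_inv w)"
    by simp
  show ?case
  proof (cases "reduce letter_inv w")
    case Nil
    with IH show ?thesis by simp
  next
    case (Cons b u)
    have "b \<in> B \<times> UNIV" "a \<in> B \<times> UNIV"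
      using set_reduce[of letter_inv w] Cons Cons.prems by auto
    then have "apfst f b = letter_inv (apfst f a) \<longleftrightarrow> b = letter_inv a"
      using assms(1) by (cases a; cases b) (auto simp: inj_on_def)
    with IH Cons show ?thesis by simp
  qed
qed simp

text \<open>
  A bijection of free bases extends to reduced words, and these are multiplied by concatenation
  and cancellation, which only see whether two letters are inverse to each other.
\<close>

lemma free_groups_iso:
  assumes "free_group_of_rank F k" "free_group_of_rank H k"
  shows "F \<cong> H"
proof -
  obtain B where F: "group F" and B: "finite B" "card B = k" "free_basis F B"
    using assms(1) unfolding free_group_of_rank_def by blast
  obtain C where H: "group H" and C: "finite C" "card C = k" "free_basis H C"
    using assms(2) unfolding free_group_of_rank_def by blast
  interpret F: group F by fact
  interpret H: group H by fact
  obtain f where f: "bij_betw f B C"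
    using finite_same_card_bij[OF B(1) C(1)] B C by auto
  then have inj: "inj_on f B" and im: "f ` B = C" by (auto simp: bij_betw_def)
  have BF: "B \<subseteq> carrier F" and CH: "C \<subseteq> carrier H"
    using B C by (auto simp: free_basis_def)
  let ?m = "map (apfst f) :: (_ \<times> bool) list \<Rightarrow> _"
  define \<psi> where "\<psi> = (\<lambda>g. word_value H (?m (basis_word F B g)))"
  have mset: "set (?m w) \<subseteq> C \<times> UNIV" if "set w \<subseteq> B \<times> UNIV" for w
    using that im by auto
  have mC: "fst ` set (?m w) \<subseteq> carrier H" if "set w \<subseteq> B \<times> UNIV" for w
    using mset[OF that] CH by fastforce
  have closed: "\<psi> g \<in> carrier H" if "g \<in> carrier F" for g
    unfolding \<psi>_def by (rule H.word_value_closed[OF mC[OF basis_word(1)[OF B(3) that]]])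
  have "\<psi> \<in> iso F H"
    unfolding iso_def
  proof (intro CollectI conjI)
    show "\<psi> \<in> hom F H"
    proof (rule homI)
      fix g h assume g: "g \<in> carrier F" and h: "h \<in> carrier F"
      note bg = basis_word[OF B(3) g] and bh = basis_word[OF B(3) h]
      have "\<psi> (g \<otimes>\<^bsub>F\<^esub> h) = word_value H (reduce letter_inv (?m (basis_word F B g @ basis_word F B h)))"
        unfolding \<psi>_def F.basis_word_mult[OF B(3) g h]
        by (subst reduce_map_letters[OF inj]) (use bg bh in auto)
      also have "\<dots> = \<psi> g \<otimes>\<^bsub>H\<^esub> \<psi> h"
      proof -
        have "fst ` set (?m (basis_word F B g) @ ?m (basis_word F B h)) \<subseteq> carrier H"
          using mC[OF bg(1)] mC[OF bh(1)] by (simp only: set_append image_Un Un_subset_iff)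
        then show ?thesis
          unfolding \<psi>_def using mC[OF bg(1)] mC[OF bh(1)]
          by (simp only: map_append H.word_value_reduce H.word_value_append)
      qed
      finally show "\<psi> (g \<otimes>\<^bsub>F\<^esub> h) = \<psi> g \<otimes>\<^bsub>H\<^esub> \<psi> h" .
    qed (auto simp: closed)
    show "bij_betw \<psi> (carrier F) (carrier H)"
    proof (rule bij_betw_imageI)
      show "inj_on \<psi> (carrier F)"
      proof (rule inj_onI)
        fix g h assume g: "g \<in> carrier F" and h: "h \<in> carrier F" and eq: "\<psi> g = \<psi> h"
        note bg = basis_word[OF B(3) g] and bh = basis_word[OF B(3) h]
        have "?m (basis_word F B g) = ?m (basis_word F B h)"
          using eq bg bh reduced_map_letters[OF inj] mset unfolding \<psi>_def
          by (intro free_basis_inj[OF C(3)]) auto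
        moreover have "inj_on (apfst f :: _ \<times> bool \<Rightarrow> _) (B \<times> UNIV)"
          using inj by (auto simp: inj_on_def)
        ultimately have "basis_word F B g = basis_word F B h"
          using bg(1) bh(1) by (blast intro: map_inj_on inj_on_subset)
        then show "g = h" using bg(3) bh(3) by metis
      qed
      show "\<psi> ` carrier F = carrier H"
      proof (intro equalityI subsetI)
        fix y assume "y \<in> carrier H"
        then obtain v where v: "set v \<subseteq> C \<times> UNIV" "reduced letter_inv v" "word_value H v = y"
          using free_basis_surj[OF C(3)] by blast
        define w where "w = map (apfst (inv_into B f)) v"
        have w: "set w \<subseteq> B \<times> UNIV" and mw: "?m w = v"
          using v(1) im by (auto simp: w_def f_inv_into_f intro!: map_idI inv_into_into)
        have "reduced letter_inv w" using reduced_map_letters[OF inj w] v(2) mw by simp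
        then have "basis_word F B (word_value F w) = w"
          by (intro basis_word_eqI[OF B(3) w]) auto
        then have "\<psi> (word_value F w) = y" using mw v(3) by (simp add: \<psi>_def)
        moreover have "word_value F w \<in> carrier F"
          using free_basis_set[OF B(3) w] by (rule F.word_value_closed)
        ultimately show "y \<in> \<psi> ` carrier F" by blast
      qed (auto simp: closed)
    qed
  qed
  then show ?thesis by (auto simp: is_iso_def)
qed

section \<open>The fundamental group of a finite connected graph\<close>

locale finite_connected_bidirected_graph = fin_digraph G + bidirected_digraph G arev
  for G :: "('v, 'e) pre_digraph" (structure) and arev :: "'e \<Rightarrow> 'e" +
  assumes connected: "Digraph_Component.connected G"
begin

sublocale involution arev
  by unfold_locales simp

abbreviation red :: "'e list \<Rightarrow> 'e list" where
  "red \<equiv> reduce arev"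

lemma reachable_in_graph: "u \<in> verts G \<Longrightarrow> w \<in> verts G \<Longrightarrow> u \<rightarrow>\<^sup>* w"
  using symmetric_connected_imp_strongly_connected[OF sym_arcs connected] by auto

text \<open>
  The form in which connectedness is used: no proper nonempty set of vertices is closed under
  following arcs.
\<close>

lemma closed_vertex_set:
  assumes "S \<subseteq> verts G" "S \<noteq> {}" "\<And>a. a \<in> arcs G \<Longrightarrow> tail G a \<in> S \<Longrightarrow> head G a \<in> S"
  shows "S = verts G"
proof -
  obtain v where v: "v \<in> S" using assms by blast
  have "w \<in> S" if "w \<in> verts G" for w
  proof -
    have "v \<rightarrow>\<^sup>* w" using reachable_in_graph that v assms(1) by blast
    then show ?thesis
      by (induction rule: reachable_induct) (use v assms(3) in \<open>auto elim: reachableE\<close>)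
  qed
  with assms(1) show ?thesis by blast
qed

lemma awalk_reduce: "awalk u p w \<Longrightarrow> awalk u (red p) w"
proof (induction p arbitrary: u)
  case (Cons a p)
  then have a: "a \<in> arcs G" "u = tail G a" and IH: "awalk (head G a) (red p) w"
    by (auto simp: awalk_Cons_iff)
  then show ?case
    by (auto simp: awalk_Cons_iff split: list.splits)
qed simp

lemma awalk_snoc: "awalk u p (tail G a) \<Longrightarrow> a \<in> arcs G \<Longrightarrow> awalk u (p @ [a]) (head G a)"
  by (rule awalk_appendI) (auto simp: awalk_simps)

lemma awalk_word_inv: "awalk u p w \<Longrightarrow> awalk w (word_inv p) u"
proof (induction p arbitrary: u)
  case (Cons a p)
  then have a: "a \<in> arcs G" "u = tail G a" and IH: "awalk w (word_inv p) (head G a)"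
    by (auto simp: awalk_Cons_iff)
  then show ?case using awalk_snoc[of w "word_inv p" "arev a"] by simp
qed (auto simp: awalk_Nil_iff)

lemma mem_fundamental_group:
  "p \<in> carrier (fundamental_group G arev v) \<longleftrightarrow> awalk v p v \<and> reduced arev p"
  by (simp add: fundamental_group_def)

lemma mult_fundamental_group: "mult (fundamental_group G arev v) p q = red (p @ q)"
  and one_fundamental_group: "one (fundamental_group G arev v) = []"
  by (simp_all add: fundamental_group_def)

lemma group_fundamental_group:
  assumes "v \<in> verts G"
  shows "group (fundamental_group G arev v)"
proof (rule groupI; unfold mem_fundamental_group mult_fundamental_group one_fundamental_group)
  fix p assume "awalk v p v \<and> reduced arev p"
  then show "\<exists>q\<in>carrier (fundamental_group G arev v). red (q @ p) = []"
    using awalk_word_inv[of v p v] reduced_word_inv[of p] reduce_cancel_left[of p "[]"]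
    by (intro bexI[of _ "word_inv p"]) (auto simp: mem_fundamental_group)
qed (use assms in \<open>auto simp: reduced_reduce awalk_Nil_iff reduce_reduced simp del: awalk_append_iff intro!: awalk_reduce intro: awalk_appendI\<close>)

lemma inv_fundamental_group:
  assumes "v \<in> verts G" "p \<in> carrier (fundamental_group G arev v)"
  shows "inv\<^bsub>fundamental_group G arev v\<^esub> p = word_inv p"
proof -
  interpret group "fundamental_group G arev v" using assms(1) by (rule group_fundamental_group)
  show ?thesis
    using assms awalk_word_inv[of v p v] reduced_word_inv[of p] reduce_cancel_left[of p "[]"]
    by (intro inv_equality)
      (auto simp: mem_fundamental_group mult_fundamental_group one_fundamental_group)
qed

subsection \<open>Spanning trees\<close>

text \<open>
  A spanning tree is given by its arcs \<open>T\<close> and, for each vertex \<open>u\<close>, a walk \<open>\<tau> u\<close> in \<open>T\<close> from the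
  root to \<open>u\<close>.  That \<open>T\<close> contains no cycle is expressed by the last condition: up to homotopy,
  prolonging \<open>\<tau>\<close> along a tree arc gives \<open>\<tau>\<close> at the head of this arc.  The set \<open>S\<close> of vertices
  reached so far is a parameter because the tree is grown one vertex at a time.
\<close>

definition tree_walks :: "'v \<Rightarrow> 'v set \<Rightarrow> 'e set \<Rightarrow> ('v \<Rightarrow> 'e list) \<Rightarrow> bool" where
  "tree_walks v S T \<tau> \<longleftrightarrow>
     T \<subseteq> arcs G \<and> arev ` T \<subseteq> T \<and> tail G ` T \<subseteq> S \<and> \<tau> v = [] \<and>
     (\<forall>u\<in>S. awalk v (\<tau> u) u \<and> set (\<tau> u) \<subseteq> T) \<and>
     (\<forall>a\<in>T. red (\<tau> (tail G a) @ [a]) = red (\<tau> (head G a)))"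

lemma tree_walks_extend:
  assumes T: "tree_walks v S T \<tau>" and a: "a \<in> arcs G" "tail G a \<in> S" "head G a \<notin> S"
    and v: "v \<in> S"
  shows "tree_walks v (insert (head G a) S) (insert a (insert (arev a) T))
    (\<tau>(head G a := \<tau> (tail G a) @ [a]))" (is "tree_walks v ?S ?T ?\<tau>")
proof -
  have T': "T \<subseteq> arcs G" "arev ` T \<subseteq> T" "tail G ` T \<subseteq> S" "\<tau> v = []"
    "\<And>u. u \<in> S \<Longrightarrow> awalk v (\<tau> u) u" "\<And>u. u \<in> S \<Longrightarrow> set (\<tau> u) \<subseteq> T"
    "\<And>b. b \<in> T \<Longrightarrow> red (\<tau> (tail G b) @ [b]) = red (\<tau> (head G b))"
    using T unfolding tree_walks_def by auto
  have head_T: "head G b \<in> S" if "b \<in> T" for b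
  proof -
    have "tail G (arev b) \<in> S" using T' that by blast
    then show ?thesis using T'(1) that by auto
  qed
  have ne: "tail G a \<noteq> head G a" using a by auto
  have "awalk v (?\<tau> u) u \<and> set (?\<tau> u) \<subseteq> ?T" if "u \<in> ?S" for u
  proof (cases "u = head G a")
    case True
    then show ?thesis
      using T'(5,6)[of "tail G a"] a awalk_snoc[of v "\<tau> (tail G a)" a] by auto
  next
    case False
    then show ?thesis using T'(5,6)[of u] that by auto
  qed
  moreover have "red (?\<tau> (tail G b) @ [b]) = red (?\<tau> (head G b))" if "b \<in> ?T" for b
  proof -
    from that consider "b \<in> T" | "b = a" | "b = arev a" by blast
    then show ?thesis
    proof cases
      case 1
      then have "tail G b \<in> S" "head G b \<in> S" using T'(3) head_T by auto
      then have "tail G b \<noteq> head G a" "head G b \<noteq> head G a" using a(3) by metis+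
      then show ?thesis using T'(7)[OF 1] by simp
    next
      case 2
      then show ?thesis using ne by simp
    next
      case 3
      have "red (\<tau> (tail G a) @ [a, arev a] @ []) = red (\<tau> (tail G a) @ [])"
        using reduce_Cons_Cons[of arev a "[]"] by (intro reduce_append_cong) simp
      then show ?thesis using 3 a ne by simp
    qed
  qed
  moreover have "?\<tau> v = []" using T' v a(3) by auto
  moreover have "?T \<subseteq> arcs G" "arev ` ?T \<subseteq> ?T" "tail G ` ?T \<subseteq> ?S"
    using T' a by auto
  ultimately show ?thesis unfolding tree_walks_def by blast
qed

lemma ex_tree_walks_card:
  assumes v: "v \<in> verts G" and n: "Suc n \<le> card (verts G)"
  shows "\<exists>S T \<tau>. S \<subseteq> verts G \<and> v \<in> S \<and> card S = Suc n \<and> card T = 2 * n \<and> tree_walks v S T \<tau>"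
  using n
proof (induction n)
  case 0
  have "tree_walks v {v} {} (\<lambda>_. [])" using v by (auto simp: tree_walks_def awalk_Nil_iff)
  then show ?case using v
    by (intro exI[of _ "{v}"] exI[of _ "{}"] exI[of _ "\<lambda>_. []"]) auto
next
  case (Suc n)
  then obtain S T \<tau> where S: "S \<subseteq> verts G" "v \<in> S" "card S = Suc n" "card T = 2 * n"
    "tree_walks v S T \<tau>" by auto
  have "S \<noteq> verts G" using S Suc.prems by auto
  then obtain a where a: "a \<in> arcs G" "tail G a \<in> S" "head G a \<notin> S"
    using closed_vertex_set[OF S(1)] S(2) by blast
  have T: "T \<subseteq> arcs G" "arev ` T \<subseteq> T" "tail G ` T \<subseteq> S" using S(5) by (auto simp: tree_walks_def)
  have fin: "finite S" "finite T"
    using finite_subset[OF S(1)] finite_subset[OF T(1)] by simp_all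
  have "a \<notin> T"
  proof
    assume "a \<in> T"
    then have "tail G (arev a) \<in> S" using T by blast
    then show False using a by simp
  qed
  moreover have "arev a \<notin> T" using T(3) a by force
  moreover have "a \<noteq> arev a" using arev_neq[OF a(1)] by simp
  ultimately have "card (insert a (insert (arev a) T)) = 2 * Suc n"
    using fin S(4) by simp
  moreover have "insert (head G a) S \<subseteq> verts G" "v \<in> insert (head G a) S"
    "card (insert (head G a) S) = Suc (Suc n)"
    using S a fin by auto
  ultimately show ?case
    using tree_walks_extend[OF S(5) a S(2)] by blast
qed

lemma ex_spanning_tree_walks:
  assumes "v \<in> verts G"
  obtains T \<tau> where "card T = 2 * (card (verts G) - 1)" "tree_walks v (verts G) T \<tau>"
proof -
  have "card (verts G) > 0" using assms by (auto simp: card_gt_0_iff)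
  then obtain S T \<tau> where S: "S \<subseteq> verts G" "card S = card (verts G)"
    "card T = 2 * (card (verts G) - 1)" "tree_walks v S T \<tau>"
    using ex_tree_walks_card[OF assms, of "card (verts G) - 1"] by auto
  then have "S = verts G" by (simp add: card_subset_eq)
  with S that show ?thesis by blast
qed

text \<open>
  One arc of each non-oriented edge is chosen; the edges are pairs since no arc is its own inverse.
\<close>

lemma ex_orientation:
  assumes "A \<subseteq> arcs G" "arev ` A \<subseteq> A"
  obtains P where "P \<subseteq> A" "P \<inter> arev ` P = {}" "P \<union> arev ` P = A" "card A = 2 * card P"
proof -
  have fin: "finite A" using finite_subset[OF assms(1)] by simp
  have "\<exists>P. P \<subseteq> A \<and> P \<inter> arev ` P = {} \<and> P \<union> arev ` P = A"
    using fin assms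
  proof (induction "card A" arbitrary: A rule: less_induct)
    case less
    show ?case
    proof (cases "A = {}")
      case False
      then obtain a where a: "a \<in> A" by blast
      let ?A = "A - {a, arev a}"
      have ne: "a \<noteq> arev a" using a less.prems arev_neq by force
      have "card ?A < card A" using a less.prems(1) by (intro psubset_card_mono) auto
      moreover have "arev ` ?A \<subseteq> ?A"
        using less.prems(3) by auto
      ultimately obtain P where P: "P \<subseteq> ?A" "P \<inter> arev ` P = {}" "P \<union> arev ` P = ?A"
        using less.hyps[of ?A] less.prems by blast
      have "insert a P \<inter> arev ` insert a P = {}"
        using P ne by auto
      moreover have "insert a P \<union> arev ` insert a P = A"
        using P a less.prems(3) by auto
      ultimately show ?thesis using P a by (intro exI[of _ "insert a P"]) auto
    qed simp
  qed
  then obtain P where P: "P \<subseteq> A" "P \<inter> arev ` P = {}" "P \<union> arev ` P = A" by blast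
  have "card A = card P + card (arev ` P)"
    using P fin by (metis card_Un_disjoint finite_imageI finite_subset)
  also have "card (arev ` P) = card P" by (rule card_image) (rule inj_on_arev)
  finally show ?thesis using P that by auto
qed


subsection \<open>Freeness\<close>

text \<open>
  The loop that goes from the root through the tree to the arc \<open>a\<close>, along \<open>a\<close>, and back through
  the tree; for \<open>a\<close> outside the tree these loops are the standard generators.
\<close>

definition loop_along :: "('v \<Rightarrow> 'e list) \<Rightarrow> 'e \<Rightarrow> 'e list" where
  "loop_along \<tau> a = \<tau> (tail G a) @ [a] @ word_inv (\<tau> (head G a))"

lemma loop_along_arev: "a \<in> arcs G \<Longrightarrow> loop_along \<tau> (arev a) = word_inv (loop_along \<tau> a)"
  by (simp add: loop_along_def)

context
  fixes v :: 'v and T :: "'e set" and \<tau> :: "'v \<Rightarrow> 'e list"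
  assumes v: "v \<in> verts G" and tree: "tree_walks v (verts G) T \<tau>"
begin

abbreviation outside :: "'e list \<Rightarrow> 'e list" where
  "outside \<equiv> filter (\<lambda>a. a \<notin> T)"

abbreviation loops :: "'e list \<Rightarrow> 'e list" where
  "loops w \<equiv> concat (map (loop_along \<tau>) w)"

lemma tree_facts:
  shows "T \<subseteq> arcs G" "\<tau> v = []"
    and "\<And>u. u \<in> verts G \<Longrightarrow> awalk v (\<tau> u) u" "\<And>u. u \<in> verts G \<Longrightarrow> set (\<tau> u) \<subseteq> T"
    and "\<And>a. a \<in> T \<Longrightarrow> red (\<tau> (tail G a) @ [a]) = red (\<tau> (head G a))"
    and "\<And>a. arev a \<in> T \<longleftrightarrow> a \<in> T"
proof -
  note t = tree[unfolded tree_walks_def]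
  show "T \<subseteq> arcs G" "\<tau> v = []"
    "\<And>u. u \<in> verts G \<Longrightarrow> awalk v (\<tau> u) u" "\<And>u. u \<in> verts G \<Longrightarrow> set (\<tau> u) \<subseteq> T"
    "\<And>a. a \<in> T \<Longrightarrow> red (\<tau> (tail G a) @ [a]) = red (\<tau> (head G a))"
    using t by auto
  have "arev a \<in> T" if "a \<in> T" for a using t that by blast
  from this this[of "arev _"] show "\<And>a. arev a \<in> T \<longleftrightarrow> a \<in> T" by auto
qed

lemma awalk_loop_along: "a \<in> arcs G \<Longrightarrow> awalk v (loop_along \<tau> a) v"
  unfolding loop_along_def
  by (intro awalk_appendI[of _ _ "tail G a"] awalk_appendI[of _ _ "head G a"] awalk_word_inv
      tree_facts arc_implies_awalk) auto

lemma awalk_loops: "set w \<subseteq> arcs G \<Longrightarrow> awalk v (loops w) v"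
  by (induction w) (auto simp: awalk_Nil_iff v simp del: awalk_append_iff
      intro!: awalk_appendI awalk_loop_along)

lemma outside_loop_along: "a \<in> arcs G - T \<Longrightarrow> outside (loop_along \<tau> a) = [a]"
proof -
  assume a: "a \<in> arcs G - T"
  then have "outside (\<tau> (tail G a)) = []" "outside (word_inv (\<tau> (head G a))) = []"
    using tree_facts(4)[of "tail G a"] tree_facts(4)[of "head G a"] tree_facts(6)
    by (auto simp: filter_empty_conv)
  with a show ?thesis by (simp add: loop_along_def)
qed

lemma outside_loops: "set w \<subseteq> arcs G - T \<Longrightarrow> outside (loops w) = w"
  by (induction w) (auto simp: outside_loop_along)

text \<open>
  The tree parts of a walk can be recovered from the order of its other arcs: replacing every
  arc by its loop inserts a detour to the root and back between consecutive arcs, and along tree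
  arcs \<open>\<tau>\<close> is compatible with the walk.
\<close>

lemma reduce_loops_outside:
  "awalk u p w \<Longrightarrow> red (loops (outside p) @ \<tau> w) = red (\<tau> u @ p)"
proof (induction p arbitrary: u)
  case (Cons a p)
  then have a: "a \<in> arcs G" "u = tail G a"
    and IH: "red (loops (outside p) @ \<tau> w) = red (\<tau> (head G a) @ p)"
    by (auto simp: awalk_Cons_iff)
  show ?case
  proof (cases "a \<in> T")
    case True
    have "red (\<tau> u @ a # p) = red ((\<tau> u @ [a]) @ p)" by simp
    also have "\<dots> = red (\<tau> (head G a) @ p)"
      using tree_facts(5)[OF True] a by (intro reduce_append_cong2) auto
    finally show ?thesis using IH True by simp
  next
    case False
    have "red (loops (outside (a # p)) @ \<tau> w) =
        red (loop_along \<tau> a @ loops (outside p) @ \<tau> w)"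
      using False by simp
    also have "\<dots> = red (loop_along \<tau> a @ \<tau> (head G a) @ p)"
      using IH by (rule reduce_append_cong)
    also have "\<dots> = red ((\<tau> (tail G a) @ [a]) @ word_inv (\<tau> (head G a)) @ \<tau> (head G a) @ p)"
      by (simp add: loop_along_def)
    also have "\<dots> = red ((\<tau> (tail G a) @ [a]) @ p)"
      by (intro reduce_append_cong reduce_cancel_left)
    finally show ?thesis using a by simp
  qed
qed (simp add: awalk_Nil_iff)

text \<open>
  By the previous lemma a closed walk inside the tree is homotopic to the empty walk.
\<close>

lemma tree_walk_trivial:
  assumes "awalk u p u" "set p \<subseteq> T" "reduced arev p"
  shows "p = []"
proof -
  have "outside p = []" using assms(2) by (auto simp: filter_empty_conv)
  then have "red (\<tau> u @ []) = red (\<tau> u @ p)"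
    using reduce_loops_outside[OF assms(1)] by simp
  then show ?thesis
    using reduce_append_cancel[of "\<tau> u" "[]" p] assms(3) by (simp add: reduce_reduced)
qed

text \<open>
  If dropping the tree arcs made an arc and its inverse adjacent, then the part of the walk
  between them would be a closed reduced walk in the tree, hence empty.
\<close>

lemma reduced_outside: "awalk u p w \<Longrightarrow> reduced arev p \<Longrightarrow> reduced arev (outside p)"
proof (induction p arbitrary: u)
  case (Cons a p)
  then have walk: "awalk (head G a) p w" and red_p: "reduced arev p"
    and IH: "reduced arev (outside p)"
    by (auto simp: awalk_Cons_iff reduced_def successively_Cons)
  show ?case
  proof (cases "a \<in> T \<or> outside p = []")
    case False
    then obtain b q where q: "outside p = b # q" by (cases "outside p") auto
    then obtain t p' where p: "p = t @ b # p'" and t: "set t \<subseteq> T"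
      by (auto simp: filter_eq_Cons_iff)
    have "b \<noteq> arev a"
    proof
      assume b: "b = arev a"
      have a: "a \<in> arcs G" using Cons.prems by (auto simp: awalk_Cons_iff)
      have "awlast (head G a) t = head G a"
        using walk a unfolding p b by (simp add: awalk_Cons_iff)
      then have "awalk (head G a) t (head G a)"
        using walk unfolding p by simp
      moreover have "reduced arev t"
        using red_p unfolding p by (simp add: reduced_def successively_append_iff)
      ultimately have "t = []" using t tree_walk_trivial by blast
      then show False using Cons.prems(2) p b by (simp add: reduced_def)
    qed
    then show ?thesis using IH q False by (simp add: reduced_def)
  qed (use IH in auto)
qed simp

lemma bij_betw_reduce_loops:
  "bij_betw (red \<circ> loops) {w. set w \<subseteq> arcs G - T \<and> reduced arev w}
     (carrier (fundamental_group G arev v))"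
proof (rule bij_betw_byWitness[where f' = outside])
  show "\<forall>w\<in>{w. set w \<subseteq> arcs G - T \<and> reduced arev w}. outside ((red \<circ> loops) w) = w"
  proof clarify
    fix w assume w: "set w \<subseteq> arcs G - T" "reduced arev w"
    then have walk: "awalk v (red (loops w)) v" by (intro awalk_reduce awalk_loops) auto
    have "outside (red (loops w)) = red (outside (red (loops w)))"
      using reduced_outside[OF walk reduced_reduce] by (simp add: reduce_reduced)
    also have "\<dots> = red (outside (loops w))"
      by (intro reduce_filter_reduce) (simp add: tree_facts(6))
    finally show "outside ((red \<circ> loops) w) = w"
      using w by (simp add: outside_loops reduce_reduced)
  qed
  show "\<forall>p\<in>carrier (fundamental_group G arev v). (red \<circ> loops) (outside p) = p"
    using reduce_loops_outside[of v _ v]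
    by (auto simp: mem_fundamental_group tree_facts(2) reduce_reduced)
  show "(red \<circ> loops) ` {w. set w \<subseteq> arcs G - T \<and> reduced arev w}
      \<subseteq> carrier (fundamental_group G arev v)"
    by (auto simp: mem_fundamental_group reduced_reduce intro!: awalk_reduce awalk_loops)
  show "outside ` carrier (fundamental_group G arev v)
      \<subseteq> {w. set w \<subseteq> arcs G - T \<and> reduced arev w}"
    using reduced_outside by (force simp: mem_fundamental_group awalk_def)
qed

text \<open>
  Reduced words in the arcs outside the tree correspond to closed reduced walks by
  \<open>bij_betw_reduce_loops\<close>.  It remains to rewrite such arcs as letters: an arc of the orientation
  \<open>P\<close> becomes a generator and its inverse arc becomes the inverse of this generator.
\<close>

lemma free_basis_loops:
  assumes P: "P \<subseteq> arcs G - T" "P \<inter> arev ` P = {}" "P \<union> arev ` P = arcs G - T"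
  shows "free_basis (fundamental_group G arev v) ((red \<circ> loop_along \<tau>) ` P)"
    and "inj_on (red \<circ> loop_along \<tau>) P"
proof -
  let ?\<pi> = "fundamental_group G arev v" and ?gen = "red \<circ> loop_along \<tau>"
  interpret group ?\<pi> by (rule group_fundamental_group[OF v])
  let ?B = "?gen ` P"
  have inj: "inj_on ?gen (arcs G - T)"
  proof (rule inj_onI)
    fix a b assume ab: "a \<in> arcs G - T" "b \<in> arcs G - T" "?gen a = ?gen b"
    have "red (outside (red (loop_along \<tau> c))) = [c]" if "c \<in> arcs G - T" for c
      using that outside_loop_along[OF that]
      by (subst reduce_filter_reduce) (simp_all add: tree_facts(6))
    then have "[a] = [b]" using ab by (metis o_apply)
    then show "a = b" by simp
  qed
  then show inj_P: "inj_on ?gen P" using P(1) by (rule inj_on_subset)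
  have gen_closed: "?gen a \<in> carrier ?\<pi>" if "a \<in> arcs G" for a
    using that by (auto simp: mem_fundamental_group reduced_reduce intro!: awalk_reduce awalk_loop_along)
  define letter where "letter a = (if a \<in> P then (?gen a, True) else (?gen (arev a), False))" for a
  have cases: "(a \<in> P \<and> arev a \<notin> P) \<or> (a \<notin> P \<and> arev a \<in> P)" if "a \<in> arcs G - T" for a
    using that P by (metis Int_iff UnE arev_arev empty_iff image_iff)
  have letter_arev: "letter (arev a) = letter_inv (letter a)" if "a \<in> arcs G - T" for a
    using cases[OF that] by (auto simp: letter_def)
  have letter_bij: "bij_betw letter (arcs G - T) (?B \<times> UNIV)"
  proof (rule bij_betw_imageI)
    show "inj_on letter (arcs G - T)"
    proof (rule inj_onI)
      fix a b assume ab: "a \<in> arcs G - T" "b \<in> arcs G - T" "letter a = letter b"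
      with cases[OF ab(1)] cases[OF ab(2)] show "a = b"
        unfolding letter_def by (auto simp: inj_on_eq_iff[OF inj_P] simp del: o_apply)
    qed
    show "letter ` (arcs G - T) = ?B \<times> UNIV"
    proof (intro equalityI subsetI)
      fix x assume "x \<in> letter ` (arcs G - T)"
      then show "x \<in> ?B \<times> UNIV" using cases by (auto simp: letter_def)
    next
      fix x assume "x \<in> ?B \<times> (UNIV :: bool set)"
      then obtain a s where a: "a \<in> P" "x = (?gen a, s)" by auto
      have "x = letter (if s then a else arev a)"
        using a cases[of a] P(1) by (auto simp: letter_def)
      moreover have "(if s then a else arev a) \<in> arcs G - T" using a P by auto
      ultimately show "x \<in> letter ` (arcs G - T)" by blast
    qed
  qed
  let ?W = "{w. set w \<subseteq> arcs G - T \<and> reduced arev w}"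
  let ?V = "{w. set w \<subseteq> ?B \<times> (UNIV :: bool set) \<and> reduced letter_inv w}"
  have reduced_letter: "reduced letter_inv (map letter w) \<longleftrightarrow> reduced arev w"
    if w: "set w \<subseteq> arcs G - T" for w
    unfolding reduced_def successively_map
  proof (rule successively_cong)
    fix a b assume "a \<in> set w" "b \<in> set w"
    then have ab: "a \<in> arcs G - T" "b \<in> arcs G - T" "arev a \<in> arcs G - T"
      using w by (auto simp: tree_facts(6))
    then show "(letter b \<noteq> letter_inv (letter a)) = (b \<noteq> arev a)"
      using inj_on_eq_iff[OF bij_betw_imp_inj_on[OF letter_bij], of b "arev a"]
      by (simp add: letter_arev)
  qed simp
  have map_letter: "bij_betw (map letter) ?W ?V"
  proof (rule bij_betw_imageI)
    have "inj_on (map letter) (lists (arcs G - T))"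
      using bij_betw_imp_inj_on[OF letter_bij] by (rule inj_on_map_lists)
    then show "inj_on (map letter) ?W" by (rule inj_on_subset) auto
    show "map letter ` ?W = ?V"
    proof (intro equalityI subsetI)
      fix x assume "x \<in> map letter ` ?W"
      then obtain w where w: "x = map letter w" "set w \<subseteq> arcs G - T" "reduced arev w" by blast
      then have "set x \<subseteq> letter ` (arcs G - T)" by auto
      then show "x \<in> ?V"
        using bij_betw_imp_surj_on[OF letter_bij] reduced_letter w by simp
    next
      fix x assume x: "x \<in> ?V"
      then have "x \<in> lists (letter ` (arcs G - T))"
        using bij_betw_imp_surj_on[OF letter_bij] by auto
      then obtain w where "x = map letter w" "set w \<subseteq> arcs G - T"
        by (auto simp: lists_image)
      with x show "x \<in> map letter ` ?W" using reduced_letter by blast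
    qed
  qed
  have letter_val: "letter_value ?\<pi> (letter a) = red (loop_along \<tau> a)" if "a \<in> arcs G - T" for a
  proof (cases "a \<in> P")
    case False
    have "letter_value ?\<pi> (letter a) = word_inv (red (loop_along \<tau> (arev a)))"
      using False inv_fundamental_group[OF v gen_closed[of "arev a"]] that
      by (simp add: letter_def)
    then show ?thesis using that by (simp add: loop_along_arev reduce_word_inv[symmetric])
  qed (simp add: letter_def)
  have val: "word_value ?\<pi> (map letter w) = red (loops w)" if "set w \<subseteq> arcs G - T" for w
    using that
    by (induction w) (auto simp: letter_val mult_fundamental_group one_fundamental_group)
  have "bij_betw (red \<circ> loops) ?W (carrier ?\<pi>)" by (rule bij_betw_reduce_loops)
  then have "bij_betw (word_value ?\<pi> \<circ> map letter) ?W (carrier ?\<pi>)"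
    by (rule bij_betw_cong[THEN iffD1, rotated]) (simp add: val)
  then have "bij_betw (word_value ?\<pi>) ?V (carrier ?\<pi>)"
    using bij_betw_comp_iff[OF map_letter] by blast
  moreover have "?B \<subseteq> carrier ?\<pi>" using gen_closed P(1) by blast
  ultimately show "free_basis ?\<pi> ?B" unfolding free_basis_def by blast
qed

end

text \<open>
  For a graph with \<open>V\<close> vertices and \<open>E\<close> non-oriented edges, that is \<open>2 * E\<close> arcs, the equation
  reads \<open>m = E - V + 1\<close>, which is the number of edges outside a spanning tree.
\<close>

theorem free_fundamental_group:
  assumes v: "v \<in> verts G"
  obtains m where "free_group_of_rank (fundamental_group G arev v) m"
    and "card (arcs G) + 2 = 2 * card (verts G) + 2 * m"
proof -
  obtain T \<tau> where T: "card T = 2 * (card (verts G) - 1)" "tree_walks v (verts G) T \<tau>"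
    using ex_spanning_tree_walks[OF v] .
  note tree = tree_facts[OF v T(2)]
  have "arev ` (arcs G - T) \<subseteq> arcs G - T" by (auto simp: tree(6))
  then obtain P where P: "P \<subseteq> arcs G - T" "P \<inter> arev ` P = {}" "P \<union> arev ` P = arcs G - T"
    "card (arcs G - T) = 2 * card P"
    using ex_orientation[OF Diff_subset] by metis
  have "finite P" using P(1) by (meson finite_Diff finite_arcs finite_subset)
  then have "free_group_of_rank (fundamental_group G arev v) (card P)"
    using free_basis_loops[OF v T(2) P(1-3)] group_fundamental_group[OF v]
    unfolding free_group_of_rank_def
    by (intro conjI exI[of _ "(red \<circ> loop_along \<tau>) ` P"]) (auto simp: card_image simp del: o_apply)
  moreover have "card (arcs G) = card T + card (arcs G - T)"
    using tree(1) by (metis card_Diff_subset card_mono finite_arcs finite_subset le_add_diff_inverse)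
  moreover have "card (verts G) > 0" using v by (auto simp: card_gt_0_iff)
  ultimately show ?thesis using that[of "card P"] P(4) T(1) by simp
qed

text \<open>
  One direction uses that the rank is an invariant, the other that free groups of equal rank are
  isomorphic.  From here on the fundamental group only matters through the number of edges.
\<close>

theorem has_fundamental_group_iff:
  assumes "free_group_of_rank F k"
  shows "has_fundamental_group G arev F \<longleftrightarrow> card (arcs G) + 2 = 2 * card (verts G) + 2 * k"
proof
  have ne: "verts G \<noteq> {}" using connected by (auto simp: connected_conv)
  assume "has_fundamental_group G arev F"
  then obtain v where v: "v \<in> verts G" "fundamental_group G arev v \<cong> F"
    using ne by (auto simp: has_fundamental_group_def)
  obtain m where m: "free_group_of_rank (fundamental_group G arev v) m"
    "card (arcs G) + 2 = 2 * card (verts G) + 2 * m"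
    using free_fundamental_group[OF v(1)] .
  have "group F" using assms by (simp add: free_group_of_rank_def)
  then have "free_group_of_rank F m" using free_group_of_rank_iso[OF m(1) _ v(2)] by simp
  then have "m = k" using free_group_of_rank_unique assms by blast
  then show "card (arcs G) + 2 = 2 * card (verts G) + 2 * k" using m by simp
next
  assume card: "card (arcs G) + 2 = 2 * card (verts G) + 2 * k"
  show "has_fundamental_group G arev F"
    unfolding has_fundamental_group_def
  proof
    fix v assume v: "v \<in> verts G"
    obtain m where m: "free_group_of_rank (fundamental_group G arev v) m"
      "card (arcs G) + 2 = 2 * card (verts G) + 2 * m"
      using free_fundamental_group[OF v] .
    then show "fundamental_group G arev v \<cong> F" using card assms free_groups_iso by auto
  qed
qed

end

section \<open>Growth of weighted transition systems\<close>

text \<open>The theorem of Bolzano and Weierstrass, applied to one coordinate after the other.\<close>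

lemma bounded_family_convergent_subsequence:
  fixes x :: "nat \<Rightarrow> 'a \<Rightarrow> real"
  assumes "finite A" "\<And>n a. a \<in> A \<Longrightarrow> x n a \<in> {0..1}"
  obtains r y where "strict_mono (r :: nat \<Rightarrow> nat)" "\<forall>a\<in>A. (\<lambda>n. x (r n) a) \<longlonglongrightarrow> y a"
proof -
  have "\<exists>r y. strict_mono (r :: nat \<Rightarrow> nat) \<and> (\<forall>a\<in>A. (\<lambda>n. x (r n) a) \<longlonglongrightarrow> y a)"
    using assms
  proof (induction A rule: finite_induct)
    case empty
    show ?case by (intro exI[of _ id]) (simp add: strict_mono_def)
  next
    case (insert b A)
    then obtain r y where r: "strict_mono (r :: nat \<Rightarrow> nat)"
      and y: "\<And>a. a \<in> A \<Longrightarrow> (\<lambda>n. x (r n) a) \<longlonglongrightarrow> y a" by (meson insertCI)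
    have "seq_compact {0..1 :: real}" by (rule compact_imp_seq_compact) simp
    then obtain l t where t: "strict_mono t" "((\<lambda>n. x (r n) b) \<circ> t) \<longlonglongrightarrow> l"
      using insert.prems[of b] by (elim seq_compactE[where f = "\<lambda>n. x (r n) b"]) auto
    have "(\<lambda>n. x (r (t n)) a) \<longlonglongrightarrow> (y(b := l)) a" if "a \<in> insert b A" for a
      using that t(2) LIMSEQ_subseq_LIMSEQ[OF y[of a] t(1)] insert.hyps by (auto simp: o_def)
    then show ?case
      using strict_mono_compose[OF r t(1)] by (intro exI[of _ "r \<circ> t"] exI[of _ "y(b := l)"]) (auto simp: o_def)
  qed
  with that show ?thesis by blast
qed

text \<open>
  A linear factor in the upper bound is harmless for exponential growth rates; it allows for the
  crude count of paths by their number of steps.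
\<close>

lemma tendsto_ln_over_id:
  fixes N :: "real \<Rightarrow> real"
  assumes "c > 0" "C > 0"
    and "eventually (\<lambda>R. c * exp (h * R) \<le> N R) at_top"
    and "eventually (\<lambda>R. N R \<le> C * (R + 1) * exp (h * R)) at_top"
  shows "((\<lambda>R. ln (N R) / R) \<longlongrightarrow> h) at_top"
proof (rule tendsto_sandwich)
  have pos: "c * exp (h * R) > 0" for R using assms by simp
  show "eventually (\<lambda>R. (ln c + h * R) / R \<le> ln (N R) / R) at_top"
    using assms(3) eventually_gt_at_top[of 0]
  proof eventually_elim
    case (elim R)
    have "ln c + h * R = ln (c * exp (h * R))" using assms(1) by (simp add: ln_mult)
    also have "\<dots> \<le> ln (N R)" using elim pos[of R] by simp
    finally show ?case using elim by (simp add: divide_right_mono)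
  qed
  show "eventually (\<lambda>R. ln (N R) / R \<le> (ln C + ln (R + 1) + h * R) / R) at_top"
    using assms(3,4) eventually_gt_at_top[of 0]
  proof eventually_elim
    case (elim R)
    have "ln (N R) \<le> ln (C * (R + 1) * exp (h * R))"
      using elim pos[of R] by (intro ln_mono) linarith+
    also have "\<dots> = ln C + ln (R + 1) + h * R" using assms(2) elim by (simp add: ln_mult)
    finally show ?case using elim by (simp add: divide_right_mono)
  qed
  show "((\<lambda>R. (ln c + h * R) / R) \<longlongrightarrow> h) at_top" by real_asymp
  show "((\<lambda>R. (ln C + ln (R + 1) + h * R) / R) \<longlongrightarrow> h) at_top" by real_asymp
qed

text \<open>
  A step into the state \<open>b\<close> has length \<open>L b\<close>.  Irreducibility is stated for sets of states instead
  of paths, since in this form it follows from a counting argument and is directly applicable to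
  the zeros of a nonnegative solution of the inequalities \<open>transfer s x a \<le> x a\<close>.
\<close>

locale transition_system =
  fixes A :: "'a set" and succ :: "'a \<Rightarrow> 'a set" and L :: "'a \<Rightarrow> real"
  assumes finite_states: "finite A" and states_nonempty: "A \<noteq> {}"
    and succ_states: "a \<in> A \<Longrightarrow> succ a \<subseteq> A" and succ_nonempty: "a \<in> A \<Longrightarrow> succ a \<noteq> {}"
    and length_pos: "a \<in> A \<Longrightarrow> 0 < L a"
    and irreducible: "Z \<subseteq> A \<Longrightarrow> (\<And>a. a \<in> Z \<Longrightarrow> succ a \<subseteq> Z) \<Longrightarrow> Z = {} \<or> Z = A"
begin

lemma finite_succ: "a \<in> A \<Longrightarrow> finite (succ a)"
  using succ_states finite_states finite_subset by blast

text \<open>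
  The matrix with entries \<open>exp (- s * L b)\<close> at the allowed steps, acting on functions of the states.
\<close>

definition transfer :: "real \<Rightarrow> ('a \<Rightarrow> real) \<Rightarrow> 'a \<Rightarrow> real" where
  "transfer s x a = (\<Sum>b\<in>succ a. exp (- (s * L b)) * x b)"

definition superharmonic :: "real \<Rightarrow> ('a \<Rightarrow> real) \<Rightarrow> bool" where
  "superharmonic s x \<longleftrightarrow> (\<forall>a\<in>A. 0 < x a \<and> transfer s x a \<le> x a)"

definition harmonic :: "real \<Rightarrow> ('a \<Rightarrow> real) \<Rightarrow> bool" where
  "harmonic s x \<longleftrightarrow> (\<forall>a\<in>A. 0 < x a \<and> transfer s x a = x a)"

subsection \<open>The critical exponent\<close>

lemma transfer_ge:
  assumes "a \<in> A" "b \<in> succ a" "\<And>b. b \<in> A \<Longrightarrow> 0 \<le> x b"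
  shows "exp (- (s * L b)) * x b \<le> transfer s x a"
  unfolding transfer_def
proof (rule member_le_sum)
  show "0 \<le> exp (- (s * L c)) * x c" if "c \<in> succ a - {b}" for c
    using that succ_states[OF assms(1)] assms(3)[of c] by auto
qed (use assms finite_succ in auto)

lemma transfer_nonneg:
  assumes "a \<in> A" "\<And>b. b \<in> A \<Longrightarrow> 0 \<le> x b"
  shows "0 \<le> transfer s x a"
  unfolding transfer_def
proof (rule sum_nonneg)
  show "0 \<le> exp (- (s * L c)) * x c" if "c \<in> succ a" for c
    using that succ_states[OF assms(1)] assms(2)[of c] by auto
qed

text \<open>
  If the function vanishes at a state, then the inequality makes it vanish at all successors.
\<close>

lemma superharmonic_nonneg_imp_pos:
  assumes "\<And>a. a \<in> A \<Longrightarrow> 0 \<le> x a" "\<And>a. a \<in> A \<Longrightarrow> transfer s x a \<le> x a"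
    and "\<exists>a\<in>A. x a \<noteq> 0"
  shows "superharmonic s x"
proof -
  let ?Z = "{a \<in> A. x a = 0}"
  have "?Z = {} \<or> ?Z = A"
  proof (rule irreducible)
    fix a assume a: "a \<in> ?Z"
    show "succ a \<subseteq> ?Z"
    proof
      fix b assume b: "b \<in> succ a"
      then have "b \<in> A" using succ_states a by auto
      moreover have "exp (- (s * L b)) * x b \<le> 0"
        using transfer_ge[of a b x s] b a assms(1,2)[of a] assms(1) by force
      ultimately show "b \<in> ?Z" using assms(1)[of b] by (auto simp: mult_le_0_iff)
    qed
  qed auto
  then have "x a \<noteq> 0" if "a \<in> A" for a using assms(3) that by blast
  then show ?thesis using assms(1,2) by (force simp: superharmonic_def less_le)
qed

text \<open>
  For negative \<open>s\<close> every step has weight greater than \<open>1\<close>, which is impossible at a state where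
  the function is minimal.
\<close>

lemma superharmonic_imp_nonneg:
  assumes "superharmonic s x"
  shows "0 \<le> s"
proof (rule ccontr)
  assume s: "\<not> 0 \<le> s"
  obtain a where a: "a \<in> A" "\<And>b. b \<in> A \<Longrightarrow> x a \<le> x b"
    using ex_min_if_finite[of "x ` A"] finite_states states_nonempty
    by (metis (no_types, lifting) finite_imageI image_iff image_is_empty linorder_not_le)
  obtain b where b: "b \<in> succ a" using succ_nonempty a by blast
  then have bA: "b \<in> A" using succ_states a by auto
  have "s * L b < 0" using s length_pos[OF bA] by (simp add: mult_neg_pos)
  then have "1 < exp (- (s * L b))" by simp
  moreover have "0 < x b" using assms bA by (auto simp: superharmonic_def)
  ultimately have "x b < exp (- (s * L b)) * x b" by simp
  also have "\<dots> \<le> transfer s x a"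
    using assms by (intro transfer_ge a b) (auto simp: superharmonic_def less_imp_le)
  also have "\<dots> \<le> x a" using assms a by (auto simp: superharmonic_def)
  finally show False using a(2)[OF bA] by simp
qed

lemma length_lower_bound:
  obtains l where "0 < l" "\<forall>a\<in>A. l \<le> L a"
  using that[of "Min (L ` A)"] finite_states states_nonempty length_pos by auto

lemma ex_superharmonic: "\<exists>s x. superharmonic s x"
proof -
  obtain l where l: "0 < l" "\<forall>a\<in>A. l \<le> L a" using length_lower_bound .
  have cA: "1 \<le> card A" using finite_states states_nonempty by (simp add: Suc_leI card_gt_0_iff)
  define s where "s = ln (card A) / l"
  have s: "0 \<le> s" using cA l by (simp add: s_def)
  have "transfer s (\<lambda>_. 1) a \<le> 1" if a: "a \<in> A" for a
  proof -
    have "transfer s (\<lambda>_. 1) a \<le> (\<Sum>b\<in>succ a. 1 / card A)"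
      unfolding transfer_def
    proof (rule sum_mono)
      fix b assume "b \<in> succ a"
      then have "l \<le> L b" using l(2) succ_states a by blast
      then have "s * l \<le> s * L b" using s by (rule mult_left_mono)
      then have "ln (card A) \<le> s * L b" using l by (simp add: s_def)
      then have "exp (- (s * L b)) \<le> exp (- ln (card A))" by simp
      also have "\<dots> = 1 / card A" using cA by (simp add: exp_minus field_simps)
      finally show "exp (- (s * L b)) * 1 \<le> 1 / card A" by simp
    qed
    also have "\<dots> = card (succ a) / card A" by simp
    also have "\<dots> \<le> 1" using card_mono[OF finite_states succ_states[OF a]] cA by (simp add: field_simps)
    finally show ?thesis .
  qed
  then have "superharmonic s (\<lambda>_. 1)" by (simp add: superharmonic_def)
  then show ?thesis by blast
qed

definition critical_exponent :: real where
  "critical_exponent = Inf {s. \<exists>x. superharmonic s x}"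

lemma critical_exponent_le: "superharmonic s x \<Longrightarrow> critical_exponent \<le> s"
  unfolding critical_exponent_def
  by (rule cInf_lower) (auto intro: bdd_belowI superharmonic_imp_nonneg)

lemma transfer_scale: "transfer s (\<lambda>a. c * x a) b = c * transfer s x b"
  by (simp add: transfer_def sum_distrib_left algebra_simps)

text \<open>
  The infimum is attained: normalised solutions for exponents that tend to the infimum have a
  convergent subsequence, and irreducibility keeps the limit positive.
\<close>

lemma ex_superharmonic_critical: "\<exists>x. superharmonic critical_exponent x"
proof -
  let ?h = critical_exponent
  have "\<exists>s x. superharmonic s x \<and> s < ?h + 1 / Suc n \<and> (\<Sum>a\<in>A. x a) = 1" for n
  proof -
    have "\<exists>s\<in>{s. \<exists>x. superharmonic s x}. s < ?h + 1 / Suc n"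
      using ex_superharmonic unfolding critical_exponent_def
      by (intro cInf_lessD) auto
    then obtain s x where s: "superharmonic s x" "s < ?h + 1 / Suc n" by blast
    let ?c = "\<Sum>a\<in>A. x a"
    have c: "0 < ?c"
      using s(1) finite_states states_nonempty by (intro sum_pos) (auto simp: superharmonic_def)
    have "superharmonic s (\<lambda>a. (1 / ?c) * x a)"
      using s(1) c unfolding superharmonic_def transfer_scale
      by (auto intro!: divide_right_mono)
    moreover have "(\<Sum>a\<in>A. (1 / ?c) * x a) = 1"
      using c by (simp add: sum_divide_distrib[symmetric])
    ultimately show ?thesis using s(2) by blast
  qed
  then obtain s x where s: "\<And>n. superharmonic (s n) (x n)" "\<And>n. s n < ?h + 1 / Suc n"
    "\<And>n. (\<Sum>a\<in>A. x n a) = 1" by metis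
  have nonneg: "0 \<le> x n a" if "a \<in> A" for n a
    using s(1)[of n] that by (auto simp: superharmonic_def less_imp_le)
  have "x n a \<le> 1" if "a \<in> A" for n a
    using s(3)[of n] member_le_sum[OF that _ finite_states, of "x n"] nonneg by auto
  then obtain r y where r: "strict_mono (r :: nat \<Rightarrow> nat)"
    and "\<forall>a\<in>A. (\<lambda>n. x (r n) a) \<longlonglongrightarrow> y a"
    using bounded_family_convergent_subsequence[OF finite_states, of x] nonneg
    by (metis atLeastAtMost_iff)
  then have y: "(\<lambda>n. x (r n) a) \<longlonglongrightarrow> y a" if "a \<in> A" for a using that by blast
  have "s \<longlonglongrightarrow> ?h"
  proof (rule tendsto_sandwich)
    show "\<forall>\<^sub>F n in sequentially. ?h \<le> s n" using critical_exponent_le[OF s(1)] by simp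
    show "\<forall>\<^sub>F n in sequentially. s n \<le> ?h + 1 / Suc n" using s(2) by (auto simp: less_imp_le)
    have "(\<lambda>n. ?h + 1 / real (Suc n)) \<longlonglongrightarrow> ?h + 0"
      by (intro tendsto_add tendsto_const lim_1_over_n[THEN LIMSEQ_Suc])
    then show "(\<lambda>n. ?h + 1 / real (Suc n)) \<longlonglongrightarrow> ?h" by simp
  qed simp
  then have s_lim: "(\<lambda>n. s (r n)) \<longlonglongrightarrow> ?h" using LIMSEQ_subseq_LIMSEQ[OF _ r] by (simp add: o_def)
  have "superharmonic ?h y"
  proof (rule superharmonic_nonneg_imp_pos)
    fix a assume a: "a \<in> A"
    show "0 \<le> y a" using y[OF a] nonneg[OF a] by (intro LIMSEQ_le_const) auto
    have "(\<lambda>n. transfer (s (r n)) (x (r n)) a) \<longlonglongrightarrow> transfer ?h y a"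
      unfolding transfer_def using succ_states[OF a] by (intro tendsto_intros s_lim y) auto
    then show "transfer ?h y a \<le> y a"
      using y[OF a] s(1) a by (intro LIMSEQ_le) (auto simp: superharmonic_def)
  next
    have "(\<lambda>n. \<Sum>a\<in>A. x (r n) a) \<longlonglongrightarrow> (\<Sum>a\<in>A. y a)" by (intro tendsto_sum y)
    then have "(\<Sum>a\<in>A. y a) = 1" using s(3) by (simp add: LIMSEQ_const_iff)
    then show "\<exists>a\<in>A. y a \<noteq> 0" by (metis sum.neutral zero_neq_one)
  qed
  then show ?thesis by blast
qed

lemma ex_strictly_smaller_exponent:
  assumes x: "\<And>a. a \<in> A \<Longrightarrow> 0 < x a" and strict: "\<And>a. a \<in> A \<Longrightarrow> transfer s x a < x a"
  shows "\<exists>t<s. superharmonic t x"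
proof -
  have "\<forall>\<^sub>F t in at_left s. transfer t x a < x a" if "a \<in> A" for a
  proof -
    have "((\<lambda>t. transfer t x a) \<longlongrightarrow> transfer s x a) (at_left s)"
      unfolding transfer_def by (intro tendsto_intros)
    then show ?thesis using strict[OF that] by (rule order_tendstoD)
  qed
  then have "\<forall>\<^sub>F t in at_left s. \<forall>a\<in>A. transfer t x a < x a"
    using finite_states by (simp add: eventually_ball_finite)
  moreover have "\<forall>\<^sub>F t in at_left s. t < s" by (simp add: eventually_at_filter)
  ultimately have "\<forall>\<^sub>F t in at_left s. t < s \<and> (\<forall>a\<in>A. transfer t x a < x a)"
    by eventually_elim simp
  then obtain t where "t < s" "\<forall>a\<in>A. transfer t x a < x a"
    using eventually_happens[of _ "at_left s"] by (auto simp: trivial_limit_at_left_real)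
  then show ?thesis using x by (auto simp: superharmonic_def less_imp_le)
qed

text \<open>
  Lowering the function slightly at a state \<open>f\<close> where the inequality is strict keeps it strict there
  and makes it strict at every state that leads to \<open>f\<close>.  By irreducibility some state with
  equality leads to such an \<open>f\<close>.
\<close>

lemma more_strict_inequalities:
  assumes x: "superharmonic s x" and "{a \<in> A. transfer s x a < x a} \<noteq> {}"
    and "{a \<in> A. transfer s x a < x a} \<noteq> A"
  shows "\<exists>y. superharmonic s y \<and>
    {a \<in> A. transfer s x a < x a} \<subset> {a \<in> A. transfer s y a < y a}"
proof -
  let ?D = "\<lambda>x. {a \<in> A. transfer s x a < x a}"
  have "\<not> (\<forall>a\<in>A - ?D x. succ a \<subseteq> A - ?D x)"
    using irreducible[of "A - ?D x"] assms(2,3) by blast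
  then obtain a f where a: "a \<in> A - ?D x" "f \<in> succ a" "f \<in> ?D x"
    using succ_states by blast
  have pos: "0 < x b" "transfer s x b \<le> x b" if "b \<in> A" for b
    using x that by (auto simp: superharmonic_def)
  have f: "f \<in> A" "transfer s x f < x f" using a by auto
  define m where "m = (x f + transfer s x f) / 2"
  have "0 \<le> transfer s x f"
    using pos by (intro transfer_nonneg f) (auto simp: less_imp_le)
  then have m: "transfer s x f < m" "m < x f" "0 < m" using f(2) pos[OF f(1)] by (auto simp: m_def)
  define y where "y = x(f := m)"
  have le: "transfer s y b \<le> transfer s x b" for b
    unfolding transfer_def y_def using m by (intro sum_mono mult_left_mono) auto
  have lt: "transfer s y a < transfer s x a"
    unfolding transfer_def
  proof (rule sum_strict_mono_ex1)
    show "finite (succ a)" using a finite_succ by auto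
    show "\<forall>b\<in>succ a. exp (- (s * L b)) * y b \<le> exp (- (s * L b)) * x b"
      using m by (auto simp: y_def)
    show "\<exists>b\<in>succ a. exp (- (s * L b)) * y b < exp (- (s * L b)) * x b"
      using m a(2) by (intro bexI[of _ f]) (auto simp: y_def)
  qed
  have D: "transfer s y b < y b" if "b \<in> insert a (?D x)" for b
  proof (cases "b = f")
    case True
    then show ?thesis using le[of f] m by (simp add: y_def)
  next
    case False
    moreover have "transfer s y b < x b"
      using that lt le[of b] pos(2)[of b] a(1) by auto
    ultimately show ?thesis by (simp add: y_def)
  qed
  have "transfer s y b \<le> y b" "0 < y b" if "b \<in> A" for b
    using D[of b] le[of b] pos[OF that] m by (cases "b = f"; auto simp: y_def f)+
  then have "superharmonic s y" by (simp add: superharmonic_def)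
  moreover have "?D x \<subset> ?D y" using D a(1) by blast
  ultimately show ?thesis by blast
qed

text \<open>
  At the critical exponent take a solution of the inequalities with as many strict ones as
  possible.  If all were strict, the exponent could be decreased; if only some were, there would
  be a solution with more of them.  So none is strict.
\<close>

theorem ex_harmonic_critical: "\<exists>x. harmonic critical_exponent x"
proof -
  let ?h = critical_exponent
  let ?D = "\<lambda>x. {a \<in> A. transfer ?h x a < x a}"
  obtain x0 where "superharmonic ?h x0" using ex_superharmonic_critical by blast
  moreover have "card (?D x) \<le> card A" for x using finite_states by (intro card_mono) auto
  ultimately obtain x where x: "superharmonic ?h x"
    and max: "\<And>y. superharmonic ?h y \<Longrightarrow> card (?D y) \<le> card (?D x)"
    using ex_has_greatest_nat[of "superharmonic ?h" x0 "\<lambda>x. card (?D x)" "Suc (card A)"]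
    by (auto simp: less_Suc_eq_le)
  have "?D x \<noteq> A"
  proof
    assume "?D x = A"
    then obtain t where "t < ?h" "superharmonic t x"
      using ex_strictly_smaller_exponent[of x ?h] x by (auto simp: superharmonic_def)
    then show False using critical_exponent_le[of t x] by simp
  qed
  moreover have "\<not> ?D x \<subset> ?D y" if "superharmonic ?h y" for y
    using max[OF that] psubset_card_mono[of "?D y" "?D x"] finite_states by auto
  ultimately have "?D x = {}" using more_strict_inequalities[OF x] by blast
  then have "harmonic ?h x" using x by (force simp: harmonic_def superharmonic_def)
  then show ?thesis by blast
qed


subsection \<open>Counting paths\<close>

definition path_length :: "'a list \<Rightarrow> real" where
  "path_length p = sum_list (map L p)"

definition is_path :: "'a list \<Rightarrow> bool" where
  "is_path p \<longleftrightarrow> set p \<subseteq> A \<and> successively (\<lambda>a b. b \<in> succ a) p"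

text \<open>
  The state \<open>a\<close> itself is not part of the list, so that its length is not counted, as in
  \<^const>\<open>transfer\<close>.
\<close>

definition continuations :: "'a \<Rightarrow> nat \<Rightarrow> 'a list set" where
  "continuations a n = {p. length p = n \<and> is_path (a # p)}"

definition short_continuations :: "'a \<Rightarrow> real \<Rightarrow> 'a list set" where
  "short_continuations a R = {p. is_path (a # p) \<and> path_length p \<le> R}"

lemma path_length_simps [simp]:
  "path_length [] = 0" "path_length (a # p) = L a + path_length p"
  "path_length (p @ q) = path_length p + path_length q"
  by (simp_all add: path_length_def)

lemma is_path_Cons_Cons: "is_path (a # b # p) \<longleftrightarrow> a \<in> A \<and> b \<in> succ a \<and> is_path (b # p)"
  using succ_states by (auto simp: is_path_def)

lemma is_path_singleton [simp]: "is_path [a] \<longleftrightarrow> a \<in> A"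
  by (simp add: is_path_def)

lemma path_length_ge:
  fixes l :: real
  assumes "\<forall>a\<in>A. l \<le> L a" "set p \<subseteq> A"
  shows "length p * l \<le> path_length p"
  using assms by (induction p) (auto simp: algebra_simps)

lemma continuations_0: "a \<in> A \<Longrightarrow> continuations a 0 = {[]}"
  by (auto simp: continuations_def)

lemma continuations_Suc:
  "a \<in> A \<Longrightarrow> continuations a (Suc n) = (\<Union>b\<in>succ a. (#) b ` continuations b n)"
  by (auto simp: continuations_def is_path_Cons_Cons length_Suc_conv)

lemma finite_continuations: "a \<in> A \<Longrightarrow> finite (continuations a n)"
proof (induction n arbitrary: a)
  case (Suc n)
  then show ?case using succ_states finite_succ by (auto simp: continuations_Suc)
qed (simp add: continuations_0)

text \<open>
  Iterating the eigenvalue equation: the weights \<open>exp (- s * length) * x\<close> of the continuations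
  with a fixed number of steps add up to the same value, whatever this number is.
\<close>

lemma harmonic_continuations:
  assumes x: "harmonic s x" and "a \<in> A"
  shows "(\<Sum>p\<in>continuations a n. exp (- (s * path_length p)) * x (last (a # p))) = x a"
  using assms(2)
proof (induction n arbitrary: a)
  case (Suc n)
  let ?w = "\<lambda>a p. exp (- (s * path_length p)) * x (last (a # p))"
  have "(\<Sum>p\<in>continuations a (Suc n). ?w a p) =
      (\<Sum>b\<in>succ a. \<Sum>p\<in>(#) b ` continuations b n. ?w a p)"
    unfolding continuations_Suc[OF Suc.prems]
    by (intro sum.UNION_disjoint finite_succ Suc.prems)
      (use succ_states Suc.prems in \<open>auto intro!: finite_continuations\<close>)
  also have "\<dots> = (\<Sum>b\<in>succ a. exp (- (s * L b)) * (\<Sum>p\<in>continuations b n. ?w b p))"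
  proof (rule sum.cong)
    fix b assume "b \<in> succ a"
    have "(\<Sum>p\<in>(#) b ` continuations b n. ?w a p) = (\<Sum>p\<in>continuations b n. ?w a (b # p))"
      by (subst sum.reindex) auto
    also have "\<dots> = (\<Sum>p\<in>continuations b n. exp (- (s * L b)) * ?w b p)"
      by (intro sum.cong) (simp_all add: exp_add[symmetric] algebra_simps)
    finally show "(\<Sum>p\<in>(#) b ` continuations b n. ?w a p) =
        exp (- (s * L b)) * (\<Sum>p\<in>continuations b n. ?w b p)"
      by (simp only: sum_distrib_left)
  qed simp
  also have "\<dots> = transfer s x a"
    unfolding transfer_def using Suc succ_states by (intro sum.cong) auto
  finally show ?case using x Suc.prems by (simp add: harmonic_def)
qed (simp add: continuations_0)

lemma harmonic_bounds:
  assumes "harmonic s x"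
  obtains m M where "0 < m" "\<forall>a\<in>A. m \<le> x a \<and> x a \<le> M"
  using that[of "Min (x ` A)" "Max (x ` A)"] finite_states states_nonempty assms
  by (auto simp: harmonic_def)

lemma harmonic_imp_nonneg: "harmonic s x \<Longrightarrow> 0 \<le> s"
  by (intro superharmonic_imp_nonneg[of s x]) (auto simp: harmonic_def superharmonic_def)

text \<open>
  Each continuation of length at most \<open>R\<close> contributes at least \<open>exp (- s * R) * m\<close> to a sum with
  value \<open>x a \<le> M\<close>.
\<close>

lemma card_continuations_le:
  assumes x: "harmonic s x" and a: "a \<in> A" and m: "0 < m" "\<forall>a\<in>A. m \<le> x a \<and> x a \<le> M"
  shows "card {p \<in> continuations a n. path_length p \<le> R} \<le> M / m * exp (s * R)"
proof -
  let ?P = "{p \<in> continuations a n. path_length p \<le> R}"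
  have s: "0 \<le> s" using harmonic_imp_nonneg[OF x] .
  have last: "last (a # p) \<in> A" if "p \<in> continuations a n" for p
    using that a last_in_set[of p] by (auto simp: continuations_def is_path_def)
  have "card ?P * (exp (- (s * R)) * m) = (\<Sum>p\<in>?P. exp (- (s * R)) * m)" by simp
  also have "\<dots> \<le> (\<Sum>p\<in>?P. exp (- (s * path_length p)) * x (last (a # p)))"
    using s m last by (intro sum_mono mult_mono) (auto simp: mult_left_mono)
  also have "\<dots> \<le> (\<Sum>p\<in>continuations a n. exp (- (s * path_length p)) * x (last (a # p)))"
  proof (rule sum_mono2)
    fix p assume "p \<in> continuations a n - ?P"
    then have "0 < x (last (a # p))" using last[of p] m by force
    then show "0 \<le> exp (- (s * path_length p)) * x (last (a # p))" by simp
  qed (use finite_continuations[OF a] in auto)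
  also have "\<dots> = x a" by (rule harmonic_continuations[OF x a])
  also have "\<dots> \<le> M" using m a by blast
  finally show ?thesis using m(1) by (simp add: exp_minus field_simps)
qed

text \<open>
  Since lengths are bounded below, at most linearly many numbers of steps occur.
\<close>

lemma card_short_continuations_le:
  assumes x: "harmonic s x"
  obtains C where "0 < C"
    "\<forall>a\<in>A. \<forall>R\<ge>0. finite (short_continuations a R) \<and>
       card (short_continuations a R) \<le> C * (R + 1) * exp (s * R)"
proof -
  obtain m M where m: "0 < m" "\<forall>a\<in>A. m \<le> x a \<and> x a \<le> M" using harmonic_bounds[OF x] .
  obtain l where l: "0 < l" "\<forall>a\<in>A. l \<le> L a" using length_lower_bound .
  obtain a0 where "a0 \<in> A" using states_nonempty by blast
  then have M: "0 < M" using m by force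
  let ?C = "(1 / l + 1) * (M / m)"
  have "finite (short_continuations a R) \<and>
       card (short_continuations a R) \<le> ?C * (R + 1) * exp (s * R)"
    if a: "a \<in> A" and R: "0 \<le> R" for a R
  proof -
    let ?N = "nat \<lfloor>R / l\<rfloor>"
    let ?P = "\<lambda>n. {p \<in> continuations a n. path_length p \<le> R}"
    have "length p \<le> ?N" if "p \<in> short_continuations a R" for p
    proof -
      have "length p * l \<le> R"
        using path_length_ge[OF l(2), of p] that
        by (auto simp: short_continuations_def is_path_def)
      then have "length p \<le> R / l" using l(1) by (simp add: field_simps)
      then show ?thesis by (simp add: le_nat_floor)
    qed
    then have sub: "short_continuations a R = (\<Union>n\<le>?N. ?P n)"
      by (auto simp: short_continuations_def continuations_def)
    have "card (short_continuations a R) \<le> (\<Sum>n\<le>?N. card (?P n))"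
      unfolding sub by (intro card_UN_le) simp
    then have "real (card (short_continuations a R)) \<le> (\<Sum>n\<le>?N. real (card (?P n)))"
      by (simp only: of_nat_sum[symmetric] of_nat_le_iff)
    also have "\<dots> \<le> (\<Sum>n\<le>?N. M / m * exp (s * R))"
      by (intro sum_mono card_continuations_le[OF x a m])
    also have "\<dots> = (?N + 1) * (M / m * exp (s * R))" by simp
    also have "\<dots> \<le> ((1 / l + 1) * (R + 1)) * (M / m * exp (s * R))"
    proof (rule mult_right_mono)
      have "?N \<le> R / l" using R l(1) by simp
      also have "R / l + 1 \<le> (1 / l + 1) * (R + 1)" using R l(1) by (simp add: field_simps)
      finally show "real (?N + 1) \<le> (1 / l + 1) * (R + 1)" by simp
    qed (use M m in simp)
    also have "\<dots> = ?C * (R + 1) * exp (s * R)" by simp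
    finally show ?thesis unfolding sub using finite_continuations[OF a] by auto
  qed
  moreover have "0 < ?C" using l M m by (intro mult_pos_pos add_pos_pos divide_pos_pos) auto
  ultimately show ?thesis using that by blast
qed

text \<open>
  The bound \<open>c * x a * exp (s * R)\<close> reproduces itself under splitting off the first step, because
  \<open>x\<close> solves the eigenvalue equation.  The constant is chosen such that for \<open>R\<close> below the maximal
  length \<open>D\<close> the empty continuation suffices.
\<close>

lemma card_short_continuations_ge:
  assumes x: "harmonic s x"
  obtains c where "0 < c" "\<forall>a\<in>A. \<forall>R\<ge>0. c * exp (s * R) \<le> card (short_continuations a R)"
proof -
  obtain m M where m: "0 < m" "\<forall>a\<in>A. m \<le> x a \<and> x a \<le> M" using harmonic_bounds[OF x] .
  obtain l where l: "0 < l" "\<forall>a\<in>A. l \<le> L a" using length_lower_bound .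
  obtain C where "0 < C" and C: "\<forall>a\<in>A. \<forall>R\<ge>0. finite (short_continuations a R) \<and>
       card (short_continuations a R) \<le> C * (R + 1) * exp (s * R)"
    using card_short_continuations_le[OF x] .
  have s: "0 \<le> s" using harmonic_imp_nonneg[OF x] .
  define D where "D = Max (L ` A)"
  have D: "L a \<le> D" if "a \<in> A" for a using finite_states that by (simp add: D_def)
  obtain a0 where "a0 \<in> A" using states_nonempty by blast
  then have M: "0 < M" using m by force
  define c where "c = 1 / (M * exp (s * D))"
  have c: "0 < c" using M by (simp add: c_def)
  have main: "c * x a * exp (s * R) \<le> card (short_continuations a R)"
    if "a \<in> A" "0 \<le> R" "R \<le> n * l" for a R and n :: nat
    using that
  proof (induction n arbitrary: a R rule: less_induct)
    case (less n)
    note a = less.prems(1)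
    show ?case
    proof (cases "R \<le> D")
      case True
      have "c * x a * exp (s * R) \<le> c * M * exp (s * D)"
        using c m a True s by (intro mult_mono mult_left_mono) (auto simp: mult_left_mono less_imp_le)
      also have "\<dots> = 1" using M by (simp add: c_def)
      also have "{[]} \<subseteq> short_continuations a R"
        using less.prems by (simp add: short_continuations_def)
      then have "1 \<le> real (card (short_continuations a R))"
        using C less.prems card_mono[of "short_continuations a R" "{[]}"] by simp
      finally show ?thesis .
    next
      case False
      then have "n \<noteq> 0" using less.prems D[OF a] length_pos[OF a] by (cases n) auto
      have IH: "c * x b * exp (s * (R - L b)) \<le> card (short_continuations b (R - L b))"
        if b: "b \<in> succ a" for b
      proof (rule less.IH)
        have bA: "b \<in> A" using succ_states a b by blast
        then have lb: "l \<le> L b" "L b \<le> D" using l D by auto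
        show "0 \<le> R - L b" using lb False by simp
        have "R - L b \<le> n * l - l" using lb less.prems(3) by simp
        also have "\<dots> = (n - 1) * l" using \<open>n \<noteq> 0\<close> by (simp add: algebra_simps of_nat_diff)
        finally show "R - L b \<le> (n - 1) * l" .
        show "n - 1 < n" using \<open>n \<noteq> 0\<close> by simp
        show "b \<in> A" by fact
      qed
      have nonneg: "0 \<le> R - L b" if "b \<in> succ a" for b
        using that succ_states[OF a] D[of b] False by auto
      have "c * x a * exp (s * R) = c * exp (s * R) * transfer s x a"
        using x a by (simp add: harmonic_def)
      also have "\<dots> = (\<Sum>b\<in>succ a. c * x b * exp (s * (R - L b)))"
        unfolding transfer_def sum_distrib_left
        by (intro sum.cong) (auto simp: algebra_simps exp_diff exp_minus field_simps)
      also have "\<dots> \<le> (\<Sum>b\<in>succ a. real (card (short_continuations b (R - L b))))"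
        by (intro sum_mono IH)
      also have "\<dots> = (\<Sum>b\<in>succ a. real (card ((#) b ` short_continuations b (R - L b))))"
        by (intro sum.cong arg_cong[of _ _ real]) (auto simp: card_image)
      also have "\<dots> = card (\<Union>b\<in>succ a. (#) b ` short_continuations b (R - L b))"
      proof (subst card_UN_disjoint)
        show "\<forall>b\<in>succ a. finite ((#) b ` short_continuations b (R - L b))"
          using C nonneg succ_states[OF a] by blast
      qed (use finite_succ[OF a] in auto)
      also have "\<dots> \<le> card (short_continuations a R)"
      proof (intro of_nat_mono card_mono)
        show "finite (short_continuations a R)" using C less.prems by blast
      qed (auto simp: short_continuations_def is_path_Cons_Cons a)
      finally show ?thesis by simp
    qed
  qed
  have "c * m * exp (s * R) \<le> card (short_continuations a R)" if "a \<in> A" "0 \<le> R" for a R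
  proof -
    obtain n :: nat where "R / l \<le> n" using real_arch_simple by blast
    then have "R \<le> n * l" using l(1) by (simp add: field_simps)
    have "c * m * exp (s * R) \<le> c * x a * exp (s * R)"
      using c m that by (intro mult_right_mono mult_left_mono) (auto simp: less_imp_le)
    also have "\<dots> \<le> card (short_continuations a R)"
      by (rule main) fact+
    finally show ?thesis .
  qed
  then show ?thesis using that[of "c * m"] c m by simp
qed

text \<open>
  Prescribing the last state costs only a constant factor, since every path can be prolonged to
  one that ends in the prescribed set by a piece of bounded length.
\<close>

definition short_continuations_into :: "'a set \<Rightarrow> 'a \<Rightarrow> real \<Rightarrow> 'a list set" where
  "short_continuations_into B a R = {p \<in> short_continuations a R. last (a # p) \<in> B}"

text \<open>
  The set of states that can be reached from \<open>a\<close> is closed under successors, hence contains all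
  states.
\<close>

lemma ex_continuation_into:
  assumes "B \<subseteq> A" "B \<noteq> {}" "a \<in> A"
  shows "\<exists>p. is_path (a # p) \<and> last (a # p) \<in> B"
proof -
  let ?Z = "{b. \<exists>p. is_path (a # p) \<and> last (a # p) = b}"
  have "?Z \<subseteq> A" using assms(3) by (auto simp: is_path_def)
  moreover have "succ b \<subseteq> ?Z" if b: "b \<in> ?Z" for b
  proof
    fix c assume c: "c \<in> succ b"
    obtain p where p: "is_path (a # p)" "last (a # p) = b" using b by blast
    have "is_path (a # p @ [c])"
      using p c succ_states[of b] \<open>?Z \<subseteq> A\<close> b
      by (auto simp: is_path_def successively_append_iff successively_Cons split: if_splits)
    then show "c \<in> ?Z" by (intro CollectI exI[of _ "p @ [c]"]) simp
  qed
  moreover have "a \<in> ?Z" using assms(3) by (intro CollectI exI[of _ "[]"]) simp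
  ultimately have "?Z = A" using irreducible[of ?Z] by blast
  moreover obtain b where "b \<in> B" using assms(2) by blast
  ultimately have "b \<in> ?Z" using assms(1) by (simp add: subset_iff)
  then show ?thesis using \<open>b \<in> B\<close> by blast
qed

lemma card_short_continuations_into_ge:
  assumes x: "harmonic s x" and B: "B \<subseteq> A" "B \<noteq> {}" and a: "a \<in> A"
  obtains c D where "0 < c" "\<forall>R\<ge>D. c * exp (s * R) \<le> card (short_continuations_into B a R)"
proof -
  obtain c where c: "0 < c"
    "\<forall>a\<in>A. \<forall>R\<ge>0. c * exp (s * R) \<le> card (short_continuations a R)"
    using card_short_continuations_ge[OF x] .
  obtain C where "0 < C" and C: "\<forall>a\<in>A. \<forall>R\<ge>0. finite (short_continuations a R) \<and>
       card (short_continuations a R) \<le> C * (R + 1) * exp (s * R)"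
    using card_short_continuations_le[OF x] .
  obtain k where k: "\<forall>b\<in>A. is_path (b # k b) \<and> last (b # k b) \<in> B"
    using ex_continuation_into[OF B] by metis
  have nonneg: "0 \<le> path_length p" if "set p \<subseteq> A" for p
    using that length_pos by (induction p) (auto intro: add_nonneg_nonneg less_imp_le)
  define D where "D = Max ((path_length \<circ> k) ` A)"
  have D: "path_length (k b) \<le> D" if "b \<in> A" for b
    using finite_states that by (auto simp: D_def)
  have D0: "0 \<le> D" using D[OF a] nonneg[of "k a"] k a by (force simp: is_path_def)
  have cA: "0 < card A" using finite_states states_nonempty by (simp add: card_gt_0_iff)
  have "c * exp (- (s * D)) / card A * exp (s * R) \<le> card (short_continuations_into B a R)"
    if R: "D \<le> R" for R
  proof -
    \<comment> \<open>Recording the old last state makes the prolongation injective, at the cost of a factor \<open>card A\<close>.\<close>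
    let ?f = "\<lambda>p. (last (a # p), p @ k (last (a # p)))"
    have lastA: "last (a # p) \<in> A" if "p \<in> short_continuations a (R - D)" for p
      using that by (auto simp: short_continuations_def is_path_def)
    have fin: "finite (short_continuations_into B a R)"
      using C a R D0 by (auto simp: short_continuations_into_def)
    have "inj_on ?f (short_continuations a (R - D))" by (auto simp: inj_on_def)
    moreover have "?f ` short_continuations a (R - D) \<subseteq> A \<times> short_continuations_into B a R"
    proof clarify
      fix p assume p: "p \<in> short_continuations a (R - D)"
      let ?b = "last (a # p)"
      have b: "?b \<in> A" by (rule lastA[OF p])
      have "is_path ((a # p) @ k ?b)"
        using p k b unfolding short_continuations_def is_path_def
        by (auto simp: successively_append_iff successively_Cons)
      moreover have "last (a # p @ k ?b) = last (?b # k ?b)" by simp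
      moreover have "path_length (p @ k ?b) \<le> R"
        using D[OF b] p by (auto simp: short_continuations_def)
      ultimately show "?b \<in> A \<and> p @ k ?b \<in> short_continuations_into B a R"
        using k b by (auto simp: short_continuations_into_def short_continuations_def)
    qed
    ultimately have "card (short_continuations a (R - D)) \<le> card (A \<times> short_continuations_into B a R)"
      using finite_states fin by (intro card_inj_on_le[of ?f]) auto
    moreover have "c * exp (s * (R - D)) \<le> card (short_continuations a (R - D))"
      using c(2) a R by simp
    ultimately have "c * exp (s * (R - D)) \<le> card A * card (short_continuations_into B a R)"
      by (simp add: card_cartesian_product flip: of_nat_mult)
    moreover have "exp (s * (R - D)) = exp (- (s * D)) * exp (s * R)"
      by (simp add: exp_add[symmetric] algebra_simps)
    ultimately show ?thesis using cA by (simp add: field_simps)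
  qed
  moreover have "0 < c * exp (- (s * D)) / card A" using c cA by simp
  ultimately show ?thesis using that by blast
qed

end

subsection \<open>Stationarity of the uniform distribution\<close>

text \<open>
  For the walk that moves to each successor with equal probability the uniform distribution is
  stationary.  No mass leaves a set \<open>Z\<close> that is closed under successors, so none can enter it
  either.
\<close>

lemma doubly_stochastic_predecessor_closed:
  fixes succ :: "'a \<Rightarrow> 'a set"
  assumes fin: "finite A" and succ: "\<And>a. a \<in> A \<Longrightarrow> succ a \<subseteq> A" "\<And>a. a \<in> A \<Longrightarrow> succ a \<noteq> {}"
    and stochastic: "\<And>b. b \<in> A \<Longrightarrow> (\<Sum>a | a \<in> A \<and> b \<in> succ a. 1 / real (card (succ a))) = 1"
    and Z: "Z \<subseteq> A" "\<And>a. a \<in> Z \<Longrightarrow> succ a \<subseteq> Z"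
    and ab: "a \<in> A" "b \<in> succ a" "b \<in> Z"
  shows "a \<in> Z"
proof (rule ccontr)
  assume "a \<notin> Z"
  let ?w = "\<lambda>a. 1 / real (card (succ a))"
  have finZ: "finite Z" using Z(1) fin finite_subset by blast
  have fs: "finite (succ c)" if "c \<in> A" for c using succ(1)[OF that] fin finite_subset by blast
  have "real (card Z) = (\<Sum>c\<in>Z. \<Sum>d\<in>succ c. ?w c)"
  proof -
    have "(\<Sum>d\<in>succ c. ?w c) = 1" if "c \<in> Z" for c
    proof -
      have "c \<in> A" using Z(1) that by blast
      then have "0 < card (succ c)" using succ(2)[of c] fs[of c] by (simp add: card_gt_0_iff)
      then show ?thesis by simp
    qed
    then show ?thesis by simp
  qed
  also have "\<dots> = (\<Sum>c\<in>Z. \<Sum>d | d \<in> Z \<and> d \<in> succ c. ?w c)"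
    using Z(2) by (intro sum.cong) auto
  also have "\<dots> = (\<Sum>d\<in>Z. \<Sum>c | c \<in> Z \<and> d \<in> succ c. ?w c)"
    using finZ by (intro sum.swap_restrict) auto
  also have "\<dots> < (\<Sum>d\<in>Z. \<Sum>c | c \<in> A \<and> d \<in> succ c. ?w c)"
  proof (rule sum_strict_mono_ex1[OF finZ])
    show "\<forall>d\<in>Z. (\<Sum>c | c \<in> Z \<and> d \<in> succ c. ?w c) \<le> (\<Sum>c | c \<in> A \<and> d \<in> succ c. ?w c)"
      using Z(1) fin by (intro ballI sum_mono2) auto
    have "(\<Sum>c | c \<in> Z \<and> b \<in> succ c. ?w c) < (\<Sum>c | c \<in> A \<and> b \<in> succ c. ?w c)"
      using Z(1) fin fs[OF ab(1)] succ(2)[OF ab(1)] ab \<open>a \<notin> Z\<close>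
      by (intro sum_strict_mono2[where b = a]) (auto simp: card_gt_0_iff)
    then show "\<exists>d\<in>Z. (\<Sum>c | c \<in> Z \<and> d \<in> succ c. ?w c) < (\<Sum>c | c \<in> A \<and> d \<in> succ c. ?w c)"
      using ab(3) by blast
  qed
  also have "\<dots> = (\<Sum>d\<in>Z. 1)" using Z(1) by (intro sum.cong stochastic) auto
  finally show False by simp
qed

lemma ln_eq_minus_one_iff: "0 < t \<Longrightarrow> ln t = t - 1 \<longleftrightarrow> (t :: real) = 1"
  using ln_eq_minus_one by auto

context transition_system
begin

text \<open>
  With \<open>q a\<close> successors of \<open>a\<close>, the numbers \<open>t a b\<close> below have mean \<open>1\<close> over \<open>b\<close>, so that
  \<open>ln t \<le> t - 1\<close> makes \<open>gap a\<close> nonnegative.  Summed over \<open>a\<close>, the contributions of \<open>ln (x a)\<close>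
  cancel by stationarity of the uniform distribution, and the sum of the gaps is the difference
  of the two sides of the inequality.  In the case of equality every gap vanishes, which forces
  \<open>t a b = 1\<close>.
\<close>

lemma harmonic_log_average:
  assumes x: "harmonic s x"
    and stochastic: "\<And>b. b \<in> A \<Longrightarrow> (\<Sum>a | a \<in> A \<and> b \<in> succ a. 1 / real (card (succ a))) = 1"
  shows "(\<Sum>a\<in>A. ln (card (succ a))) \<le> s * (\<Sum>a\<in>A. L a)"
    and "(\<Sum>a\<in>A. ln (card (succ a))) = s * (\<Sum>a\<in>A. L a) \<Longrightarrow> a \<in> A \<Longrightarrow> b \<in> succ a \<Longrightarrow>
      exp (- (s * L b)) * x b * card (succ a) = x a"
proof -
  define q where "q a = real (card (succ a))" for a
  define t where "t a b = exp (- (s * L b)) * x b * q a / x a" for a b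
  have q: "0 < q a" if "a \<in> A" for a
    using succ_nonempty[OF that] finite_succ[OF that] by (simp add: q_def card_gt_0_iff)
  have pos: "0 < x a" "transfer s x a = x a" if "a \<in> A" for a
    using x that by (auto simp: harmonic_def)
  have pos_succ: "0 < x b" "b \<in> A" if "a \<in> A" "b \<in> succ a" for a b
    using pos succ_states that by blast+
  have t: "0 < t a b" if "a \<in> A" "b \<in> succ a" for a b
    using that pos pos_succ q by (simp add: t_def)
  define gap where "gap a = (\<Sum>b\<in>succ a. (t a b - 1 - ln (t a b)) / q a)" for a
  have gap_nonneg: "0 \<le> gap a" if "a \<in> A" for a
    unfolding gap_def using q[OF that] t[OF that] ln_le_minus_one
    by (intro sum_nonneg divide_nonneg_pos) (auto simp: diff_right_commute)
  have gap_eq: "gap a = ln (x a) - ln (q a) + (\<Sum>b\<in>succ a. (s * L b - ln (x b)) / q a)"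
    if a: "a \<in> A" for a
  proof -
    have "(\<Sum>b\<in>succ a. t a b) = transfer s x a * q a / x a"
      unfolding t_def transfer_def by (simp add: sum_distrib_right sum_divide_distrib)
    then have sum_t: "(\<Sum>b\<in>succ a. t a b) = q a" using pos[OF a] by simp
    have ln_t: "ln (t a b) = ln (q a) - ln (x a) - (s * L b - ln (x b))" if "b \<in> succ a" for b
      using pos[OF a] pos_succ[OF a that] q[OF a] by (simp add: t_def ln_mult ln_div)
    have "gap a = ((\<Sum>b\<in>succ a. t a b) - q a - (\<Sum>b\<in>succ a. ln (t a b))) / q a"
      unfolding gap_def by (simp add: sum_divide_distrib[symmetric] sum_subtractf q_def)
    also have "\<dots> = - (\<Sum>b\<in>succ a. ln (q a) - ln (x a) - (s * L b - ln (x b))) / q a"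
      using sum_t ln_t by (simp cong: sum.cong)
    also have "(\<Sum>b\<in>succ a. ln (q a) - ln (x a) - (s * L b - ln (x b))) =
        q a * (ln (q a) - ln (x a)) - (\<Sum>b\<in>succ a. s * L b - ln (x b))"
      by (subst sum_subtractf) (simp add: q_def)
    also have "- (q a * (ln (q a) - ln (x a)) - (\<Sum>b\<in>succ a. s * L b - ln (x b))) =
        q a * (ln (x a) - ln (q a)) + (\<Sum>b\<in>succ a. s * L b - ln (x b))"
      by (simp only: minus_diff_eq right_diff_distrib)
    also have "(q a * (ln (x a) - ln (q a)) + (\<Sum>b\<in>succ a. s * L b - ln (x b))) / q a =
        ln (x a) - ln (q a) + (\<Sum>b\<in>succ a. (s * L b - ln (x b)) / q a)"
      using q[OF a] by (simp add: add_divide_distrib sum_divide_distrib)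
    finally show ?thesis .
  qed
  have "(\<Sum>a\<in>A. \<Sum>b\<in>succ a. (s * L b - ln (x b)) / q a) =
      (\<Sum>a\<in>A. \<Sum>b | b \<in> A \<and> b \<in> succ a. (s * L b - ln (x b)) / q a)"
    using succ_states by (intro sum.cong) auto
  also have "\<dots> = (\<Sum>b\<in>A. \<Sum>a | a \<in> A \<and> b \<in> succ a. (s * L b - ln (x b)) / q a)"
    using finite_states by (intro sum.swap_restrict)
  also have "\<dots> = (\<Sum>b\<in>A. (s * L b - ln (x b)) * (\<Sum>a | a \<in> A \<and> b \<in> succ a. 1 / q a))"
    by (simp add: sum_distrib_left)
  also have "\<dots> = (\<Sum>b\<in>A. s * L b - ln (x b))"
    using stochastic by (simp add: q_def)
  finally have swap: "(\<Sum>a\<in>A. \<Sum>b\<in>succ a. (s * L b - ln (x b)) / q a) = (\<Sum>b\<in>A. s * L b - ln (x b))" .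
  have "(\<Sum>a\<in>A. gap a) = (\<Sum>a\<in>A. ln (x a) - ln (q a) + (\<Sum>b\<in>succ a. (s * L b - ln (x b)) / q a))"
    by (rule sum.cong[OF HOL.refl gap_eq])
  then have total: "(\<Sum>a\<in>A. gap a) = s * (\<Sum>a\<in>A. L a) - (\<Sum>a\<in>A. ln (q a))"
    using swap by (simp add: sum.distrib sum_subtractf sum_distrib_left)
  then show "(\<Sum>a\<in>A. ln (card (succ a))) \<le> s * (\<Sum>a\<in>A. L a)"
    using sum_nonneg[of A gap] gap_nonneg by (simp add: q_def)
  assume "(\<Sum>a\<in>A. ln (card (succ a))) = s * (\<Sum>a\<in>A. L a)" and a: "a \<in> A" and b: "b \<in> succ a"
  then have "(\<Sum>a\<in>A. gap a) = 0" using total by (simp add: q_def)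
  then have "gap a = 0" using sum_nonneg_eq_0_iff[OF finite_states] gap_nonneg a by blast
  then have gap0: "(\<Sum>b\<in>succ a. (t a b - 1 - ln (t a b)) / q a) = 0" by (simp add: gap_def)
  have nn: "0 \<le> (t a c - 1 - ln (t a c)) / q a" if "c \<in> succ a" for c
    using q[OF a] t[OF a that] ln_le_minus_one[of "t a c"] by simp
  have "(t a b - 1 - ln (t a b)) / q a = 0"
    by (rule sum_nonneg_0[OF finite_succ[OF a] nn gap0 b])
  then have "ln (t a b) = t a b - 1" using q[OF a] by simp
  then have "t a b = 1" using t[OF a b] ln_eq_minus_one_iff by blast
  then show "exp (- (s * L b)) * x b * card (succ a) = x a"
    using pos(1)[OF a] by (simp add: t_def q_def)
qed

end

section \<open>Volume entropy\<close>

locale metric_graph_min_degree_3 = finite_connected_bidirected_graph G arev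
  for G :: "('v, 'e) pre_digraph" (structure) and arev :: "'e \<Rightarrow> 'e" +
  fixes L :: "'e \<Rightarrow> real"
  assumes metric: "metric_structure G arev L"
    and min_degree: "u \<in> verts G \<Longrightarrow> 3 \<le> out_degree G u"
begin

lemma L_pos: "a \<in> arcs G \<Longrightarrow> 0 < L a" and L_arev: "a \<in> arcs G \<Longrightarrow> L (arev a) = L a"
  using metric by (auto simp: metric_structure_def)

definition turns :: "'e \<Rightarrow> 'e set" where
  "turns a = {b \<in> arcs G. tail G b = head G a \<and> b \<noteq> arev a}"

lemma turns_subset: "turns a \<subseteq> arcs G"
  by (auto simp: turns_def)

lemma verts_nonempty: "verts G \<noteq> {}"
  using connected by (auto simp: connected_conv)

lemma card_turns: "a \<in> arcs G \<Longrightarrow> card (turns a) = out_degree G (head G a) - 1"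
proof -
  assume a: "a \<in> arcs G"
  then have "turns a = out_arcs G (head G a) - {arev a}" "arev a \<in> out_arcs G (head G a)"
    by (auto simp: turns_def)
  then show ?thesis by (simp add: out_degree_def)
qed

lemma turns_nonempty: "a \<in> arcs G \<Longrightarrow> turns a \<noteq> {}"
  using card_turns[of a] min_degree[of "head G a"] by force

text \<open>
  The arcs from which one can turn into \<open>b\<close> are the inverses of the other arcs at the tail of \<open>b\<close>,
  and all of them offer the same number of turns.
\<close>

lemma turns_stochastic:
  assumes b: "b \<in> arcs G"
  shows "(\<Sum>a | a \<in> arcs G \<and> b \<in> turns a. 1 / real (card (turns a))) = 1"
proof -
  let ?O = "out_arcs G (tail G b) - {b}"
  have eq: "{a \<in> arcs G. b \<in> turns a} = arev ` ?O"
  proof (intro equalityI subsetI)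
    fix a assume "a \<in> {a \<in> arcs G. b \<in> turns a}"
    then have "arev a \<in> ?O" "a = arev (arev a)" by (auto simp: turns_def)
    then show "a \<in> arev ` ?O" by blast
  qed (use b in \<open>auto simp: turns_def\<close>)
  have "3 \<le> out_degree G (tail G b)" using min_degree b by simp
  moreover have "card ?O = out_degree G (tail G b) - 1"
    using b by (simp add: out_degree_def)
  moreover have "card (turns a) = out_degree G (tail G b) - 1" if "a \<in> {a \<in> arcs G. b \<in> turns a}" for a
    using that card_turns[of a] by (auto simp: turns_def)
  moreover have "card (arev ` ?O) = card ?O" by (rule card_image) (rule inj_on_arev)
  ultimately show ?thesis using eq by simp
qed

lemma third_arc:
  assumes "u \<in> verts G"
  obtains c where "c \<in> out_arcs G u" "c \<noteq> a" "c \<noteq> b"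
proof -
  have "card (out_arcs G u - {a, b}) \<ge> card (out_arcs G u) - card {a, b}"
    by (rule diff_card_le_card_Diff) simp
  moreover have "card {a, b} \<le> 2" by (simp add: card_insert_if)
  moreover have "3 \<le> card (out_arcs G u)" using min_degree[OF assms] by (simp add: out_degree_def)
  ultimately have "0 < card (out_arcs G u - {a, b})" by linarith
  then have "out_arcs G u - {a, b} \<noteq> {}" by (auto simp only: card_gt_0_iff)
  then show ?thesis using that by blast
qed

text \<open>
  A set \<open>Z\<close> that is closed under turns is also closed under reversed turns.  It then contains the
  inverse of each of its arcs \<open>a\<close>: at the head of \<open>a\<close> there are two further arcs \<open>b\<close> and \<open>c\<close>, and
  \<open>a\<close> turns into \<open>c\<close>, into which \<open>arev b\<close> also turns, and \<open>arev b\<close> turns into \<open>arev a\<close>.  So \<open>Z\<close>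
  contains every arc at the head of one of its arcs, and connectedness finishes the proof.
\<close>

lemma turns_irreducible:
  assumes Z: "Z \<subseteq> arcs G" "\<And>a. a \<in> Z \<Longrightarrow> turns a \<subseteq> Z"
  shows "Z = {} \<or> Z = arcs G"
proof (cases "Z = {}")
  case False
  have pred: "a \<in> Z" if "a \<in> arcs G" "b \<in> turns a" "b \<in> Z" for a b
    using doubly_stochastic_predecessor_closed[of "arcs G" turns Z a b] that Z turns_subset
      turns_nonempty turns_stochastic finite_arcs by blast
  let ?S = "head G ` Z"
  have out: "e \<in> Z" if e: "e \<in> arcs G" and u: "tail G e \<in> ?S" for e
  proof -
    obtain a where a: "a \<in> Z" "head G a = tail G e" using u by auto
    then have aG: "a \<in> arcs G" using Z by blast
    show ?thesis
    proof (cases "e = arev a")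
      case False
      then have "e \<in> turns a" using e a by (simp add: turns_def)
      then show ?thesis using Z(2) a by blast
    next
      case True
      obtain b where b: "b \<in> out_arcs G (tail G e)" "b \<noteq> e"
        using third_arc[of "tail G e" e e] e by auto
      obtain c where c: "c \<in> out_arcs G (tail G e)" "c \<noteq> e" "c \<noteq> b"
        using third_arc[of "tail G e" e b] e by auto
      have "c \<in> turns a" using c a True by (auto simp: turns_def)
      then have "c \<in> Z" using Z(2) a by blast
      moreover have "c \<in> turns (arev b)" using b c by (auto simp: turns_def)
      ultimately have "arev b \<in> Z" using pred[of "arev b" c] b by auto
      moreover have "e \<in> turns (arev b)" using b e by (auto simp: turns_def)
      ultimately show ?thesis using Z(2) by blast
    qed
  qed
  have "?S = verts G"
  proof (rule closed_vertex_set)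
    show "?S \<subseteq> verts G" using Z(1) by auto
    show "?S \<noteq> {}" using False by simp
    show "head G a \<in> ?S" if "a \<in> arcs G" "tail G a \<in> ?S" for a using out[OF that] by blast
  qed
  then have "arcs G \<subseteq> Z" using out by auto
  then show ?thesis using Z(1) by blast
qed simp

sublocale nbw: transition_system "arcs G" turns L
proof
  obtain u where "u \<in> verts G" using verts_nonempty by blast
  then obtain c where "c \<in> out_arcs G u" using third_arc by metis
  then show "arcs G \<noteq> {}" by auto
  show "Z = {} \<or> Z = arcs G" if "Z \<subseteq> arcs G" "\<And>a. a \<in> Z \<Longrightarrow> turns a \<subseteq> Z" for Z
    using that by (rule turns_irreducible)
qed (simp_all add: turns_subset turns_nonempty L_pos)

lemma nbw_path_iff:
  "nbw.is_path (a # p) \<longleftrightarrow> awalk (tail G a) (a # p) (head G (last (a # p))) \<and> reduced arev (a # p)"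
proof (induction p arbitrary: a)
  case Nil
  show ?case by (auto simp: awalk_simps)
next
  case (Cons b p)
  show ?case
    unfolding nbw.is_path_Cons_Cons Cons.IH
    by (auto simp: awalk_Cons_iff turns_def reduced_def)
qed

lemma awalk_Cons_last:
  "awalk u (a # p) w \<Longrightarrow> u = tail G a \<and> w = head G (last (a # p))"
  by (induction p arbitrary: u a) (auto simp: awalk_simps)

subsection \<open>Distances in the universal cover\<close>

lemma cover_simps:
  "verts (universal_cover G arev v) = {p. (\<exists>u. awalk v p u) \<and> reduced arev p}"
  "arcs (universal_cover G arev v) = {(p, a). awalk v p (tail G a) \<and> reduced arev p \<and> a \<in> arcs G}"
  "tail (universal_cover G arev v) = fst"
  "head (universal_cover G arev v) = (\<lambda>(p, a). red (p @ [a]))"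
  by (simp_all add: universal_cover_def)

lemma wf_digraph_cover: "wf_digraph (universal_cover G arev v)"
proof
  fix e assume "e \<in> arcs (universal_cover G arev v)"
  then obtain p a where e: "e = (p, a)" "awalk v p (tail G a)" "reduced arev p" "a \<in> arcs G"
    by (auto simp: cover_simps)
  then show "tail (universal_cover G arev v) e \<in> verts (universal_cover G arev v)"
    by (auto simp: cover_simps)
  show "head (universal_cover G arev v) e \<in> verts (universal_cover G arev v)"
    using awalk_reduce[OF awalk_snoc[OF e(2,4)]] e by (auto simp: cover_simps reduced_reduce)
qed

lemma cover_awalk_end:
  assumes "pre_digraph.awalk (universal_cover G arev v) x q y"
  shows "y = red (x @ map snd q) \<and> set (map snd q) \<subseteq> arcs G"
proof -
  interpret U: wf_digraph "universal_cover G arev v" by (rule wf_digraph_cover)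
  show ?thesis using assms
  proof (induction q arbitrary: x)
    case Nil
    then show ?case by (auto simp: U.awalk_Nil_iff cover_simps reduce_reduced)
  next
    case (Cons e q)
    then obtain a where e: "e = (x, a)" "a \<in> arcs G" and q: "U.awalk (red (x @ [a])) q y"
      by (auto simp: U.awalk_Cons_iff cover_simps)
    have "y = red (red (x @ [a]) @ map snd q) \<and> set (map snd q) \<subseteq> arcs G"
      using Cons.IH[OF q] .
    then show ?case using e by simp
  qed
qed

lemma ex_cover_awalk:
  assumes "awalk v x u" "reduced arev x" "awalk u w u'"
  shows "\<exists>q. pre_digraph.awalk (universal_cover G arev v) x q (red (x @ w)) \<and> map snd q = w"
proof -
  interpret U: wf_digraph "universal_cover G arev v" by (rule wf_digraph_cover)
  show ?thesis using assms
  proof (induction w arbitrary: x u)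
    case Nil
    then show ?case
      by (intro exI[of _ "[]"]) (auto simp: U.awalk_Nil_iff cover_simps reduce_reduced)
  next
    case (Cons a w)
    then have a: "u = tail G a" "a \<in> arcs G" and w: "awalk (head G a) w u'"
      by (auto simp: awalk_Cons_iff)
    have "awalk v (red (x @ [a])) (head G a)"
      using Cons.prems(1) a by (intro awalk_reduce awalk_snoc) auto
    then obtain q where "U.awalk (red (x @ [a])) q (red (red (x @ [a]) @ w))" "map snd q = w"
      using Cons.IH[of "red (x @ [a])" "head G a"] w reduced_reduce by blast
    then show ?case
      using Cons.prems a
      by (intro exI[of _ "(x, a) # q"]) (auto simp: U.awalk_Cons_iff cover_simps)
  qed
qed

text \<open>
  All walks in the cover from \<open>x\<close> to its translate project to homotopic walks in the graph, and the
  reduced one among these is the shortest.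
\<close>

lemma cover_dist_deck_action:
  assumes x: "awalk v x u" "reduced arev x" and g: "awalk v g v"
  shows "cover_dist G arev L v x (deck_action arev g x) =
    ereal (nbw.path_length (red (word_inv x @ g @ x)))"
proof -
  interpret U: wf_digraph "universal_cover G arev v" by (rule wf_digraph_cover)
  let ?w = "red (word_inv x @ g @ x)"
  have w: "awalk u ?w u"
    by (rule awalk_reduce) (use x g in \<open>auto simp del: awalk_append_iff intro!: awalk_appendI awalk_word_inv\<close>)
  have xw: "red (x @ ?w) = red (g @ x)"
    using reduce_cancel_right[of x "g @ x"] by simp
  have cost: "U.awalk_cost (\<lambda>(p, a). L a) q = nbw.path_length (map snd q)" for q
    by (simp add: U.awalk_cost_def nbw.path_length_def o_def case_prod_unfold)
  show ?thesis
    unfolding cover_dist_def deck_action_def U.\<mu>_def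
  proof (rule antisym)
    obtain q where "U.awalk x q (red (g @ x))" "map snd q = ?w"
      using ex_cover_awalk[OF x w] xw by auto
    then show "(INF q\<in>{q. U.awalk x q (red (g @ x))}. ereal (U.awalk_cost (\<lambda>(p, a). L a) q))
        \<le> ereal (nbw.path_length ?w)"
      by (intro INF_lower2[of q]) (auto simp: cost)
    show "ereal (nbw.path_length ?w)
        \<le> (INF q\<in>{q. U.awalk x q (red (g @ x))}. ereal (U.awalk_cost (\<lambda>(p, a). L a) q))"
    proof (rule INF_greatest)
      fix q assume "q \<in> {q. U.awalk x q (red (g @ x))}"
      then have q: "red (g @ x) = red (x @ map snd q)" "set (map snd q) \<subseteq> arcs G"
        using cover_awalk_end by auto
      have "red (x @ ?w) = red (x @ map snd q)" using xw q(1) by simp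
      then have "?w = red (map snd q)" by (simp only: reduce_append_cancel reduce_idem)
      moreover have "nbw.path_length (red (map snd q)) \<le> nbw.path_length (map snd q)"
        unfolding nbw.path_length_def
        using q(2) L_pos by (intro sum_list_reduce_le) (auto simp: subset_iff less_imp_le)
      ultimately show "ereal (nbw.path_length ?w) \<le> ereal (U.awalk_cost (\<lambda>(p, a). L a) q)"
        by (simp add: cost)
    qed
  qed
qed

subsection \<open>Closed reduced walks\<close>

definition closed_walks :: "'v \<Rightarrow> real \<Rightarrow> 'e list set" where
  "closed_walks u R = {p. awalk u p u \<and> reduced arev p \<and> nbw.path_length p \<le> R}"

text \<open>
  Conjugation by \<open>x\<close> identifies the fundamental group at \<open>v\<close> with the one at the endpoint \<open>u\<close> of \<open>x\<close>,
  where displacement is just the length of the closed reduced walk.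
\<close>

lemma card_orbit_ball:
  assumes x: "awalk v x u" "reduced arev x"
  shows "card {g \<in> carrier (fundamental_group G arev v).
      cover_dist G arev L v x (deck_action arev g x) \<le> ereal R} = card (closed_walks u R)"
proof (rule bij_betw_same_card, rule bij_betw_byWitness[where f' = "\<lambda>p. red (x @ p @ word_inv x)"])
  let ?f = "\<lambda>g. red (word_inv x @ g @ x)" and ?f' = "\<lambda>p. red (x @ p @ word_inv x)"
  let ?A = "{g \<in> carrier (fundamental_group G arev v).
      cover_dist G arev L v x (deck_action arev g x) \<le> ereal R}"
  have inv1: "red (x @ ?f g @ word_inv x) = g" if "reduced arev g" for g
  proof -
    have "red (x @ ?f g @ word_inv x) = red (x @ (word_inv x @ g @ x) @ word_inv x)"
      by (intro reduce_append_cong) simp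
    also have "\<dots> = red (g @ x @ word_inv x)" using reduce_cancel_right[of x "g @ x @ word_inv x"] by simp
    also have "\<dots> = red (g @ [])" using reduce_cancel_right[of x "[]"] by (intro reduce_append_cong) simp
    finally show ?thesis using that by (simp add: reduce_reduced)
  qed
  have inv2: "red (word_inv x @ ?f' p @ x) = p" if "reduced arev p" for p
  proof -
    have "red (word_inv x @ ?f' p @ x) = red (word_inv x @ (x @ p @ word_inv x) @ x)"
      by (intro reduce_append_cong) simp
    also have "\<dots> = red (p @ word_inv x @ x)" using reduce_cancel_left[of x "p @ word_inv x @ x"] by simp
    also have "\<dots> = red (p @ [])" using reduce_cancel_left[of x "[]"] by (intro reduce_append_cong) simp
    finally show ?thesis using that by (simp add: reduce_reduced)
  qed
  have walk: "awalk u (?f g) u" if "awalk v g v" for g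
    by (rule awalk_reduce) (use x that in \<open>auto simp del: awalk_append_iff intro!: awalk_appendI awalk_word_inv\<close>)
  have walk': "awalk v (?f' p) v" if "awalk u p u" for p
    by (rule awalk_reduce) (use x that in \<open>auto simp del: awalk_append_iff intro!: awalk_appendI awalk_word_inv\<close>)
  show "\<forall>g\<in>?A. red (x @ ?f g @ word_inv x) = g"
    using inv1 by (auto simp: mem_fundamental_group)
  show "\<forall>p\<in>closed_walks u R. ?f (?f' p) = p"
    using inv2 by (auto simp: closed_walks_def)
  show "?f ` ?A \<subseteq> closed_walks u R"
    using walk cover_dist_deck_action[OF x]
    by (auto simp: mem_fundamental_group closed_walks_def reduced_reduce)
  show "?f' ` closed_walks u R \<subseteq> ?A"
  proof clarify
    fix p assume "p \<in> closed_walks u R"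
    then have p: "awalk u p u" "reduced arev p" "nbw.path_length p \<le> R"
      by (auto simp: closed_walks_def)
    show "?f' p \<in> carrier (fundamental_group G arev v) \<and>
        cover_dist G arev L v x (deck_action arev (?f' p) x) \<le> ereal R"
      using walk'[OF p(1)] cover_dist_deck_action[OF x walk'[OF p(1)]] inv2[OF p(2)] p(3)
      by (simp only: mem_fundamental_group reduced_reduce) simp
  qed
qed

text \<open>
  Splitting off the first arc turns closed reduced walks at \<open>u\<close> into continuations of this arc that
  end in an arc towards \<open>u\<close>.
\<close>

lemma closed_walks_growth:
  assumes h: "nbw.harmonic h x" and u: "u \<in> verts G"
  shows "((\<lambda>R. ln (card (closed_walks u R)) / R) \<longlongrightarrow> h) at_top"
proof -
  have h0: "0 \<le> h" using nbw.harmonic_imp_nonneg[OF h] .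
  obtain C where C0: "0 < C" and C: "\<forall>a\<in>arcs G. \<forall>R\<ge>0. finite (nbw.short_continuations a R) \<and>
       card (nbw.short_continuations a R) \<le> C * (R + 1) * exp (h * R)"
    using nbw.card_short_continuations_le[OF h] .
  obtain a where "a \<in> out_arcs G u" using third_arc[OF u] by metis
  then have a: "a \<in> arcs G" "tail G a = u" by simp_all
  have arevs: "in_arcs G u \<subseteq> arcs G" "in_arcs G u \<noteq> {}" using a by (auto simp: in_arcs_eq)
  obtain c D where c: "0 < c"
    "\<forall>R\<ge>D. c * exp (h * R) \<le> card (nbw.short_continuations_into (in_arcs G u) a R)"
    using nbw.card_short_continuations_into_ge[OF h arevs a(1)] .
  have mem: "a # p \<in> closed_walks u R \<longleftrightarrow>
      tail G a = u \<and> last (a # p) \<in> in_arcs G u \<and> p \<in> nbw.short_continuations a (R - L a)" for a p R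
  proof -
    have "awalk u (a # p) u \<longleftrightarrow> tail G a = u \<and> head G (last (a # p)) = u \<and>
        awalk (tail G a) (a # p) (head G (last (a # p)))"
      using awalk_Cons_last[of u a p u] by auto
    moreover have "last (a # p) \<in> arcs G" if "awalk u (a # p) u"
      using that last_in_set[of "a # p"] by (auto simp: awalk_def)
    moreover have "nbw.path_length (a # p) \<le> R \<longleftrightarrow> nbw.path_length p \<le> R - L a" by auto
    ultimately show ?thesis
      unfolding closed_walks_def nbw.short_continuations_def mem_Collect_eq nbw_path_iff
        in_in_arcs_conv by argo
  qed
  have sub: "closed_walks u R \<subseteq> insert [] (\<Union>a\<in>out_arcs G u. (#) a ` nbw.short_continuations a R)"
    for R
  proof
    fix p assume p: "p \<in> closed_walks u R"
    show "p \<in> insert [] (\<Union>a\<in>out_arcs G u. (#) a ` nbw.short_continuations a R)"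
    proof (cases p)
      case (Cons b q)
      then have b: "tail G b = u" "q \<in> nbw.short_continuations b (R - L b)" using p mem by auto
      then have "b \<in> arcs G" by (auto simp: nbw.short_continuations_def nbw.is_path_def)
      then have "q \<in> nbw.short_continuations b R"
        using b L_pos[of b] by (auto simp: nbw.short_continuations_def)
      then show ?thesis using Cons b \<open>b \<in> arcs G\<close> by auto
    qed simp
  qed
  let ?U = "\<lambda>R. \<Union>a\<in>out_arcs G u. (#) a ` nbw.short_continuations a R"
  have fin: "finite (?U R)" if "0 \<le> R" for R using C that by auto
  show ?thesis
  proof (rule tendsto_ln_over_id)
    show "\<forall>\<^sub>F R in at_top. c * exp (- (h * L a)) * exp (h * R) \<le> card (closed_walks u R)"
      using eventually_ge_at_top[of "D + L a"] eventually_ge_at_top[of 0]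
    proof eventually_elim
      case (elim R)
      let ?P = "nbw.short_continuations_into (in_arcs G u) a (R - L a)"
      have "(#) a ` ?P \<subseteq> closed_walks u R"
        using a mem unfolding nbw.short_continuations_into_def by blast
      moreover have "finite (closed_walks u R)"
        using finite_subset[OF sub] fin[OF elim(2)] by auto
      ultimately have "card ((#) a ` ?P) \<le> card (closed_walks u R)" by (intro card_mono)
      moreover have "card ((#) a ` ?P) = card ?P" by (intro card_image) simp
      moreover have "c * exp (h * (R - L a)) \<le> card ?P" using c(2) elim by auto
      moreover have "exp (h * (R - L a)) = exp (- (h * L a)) * exp (h * R)"
        by (simp add: exp_add[symmetric] algebra_simps)
      ultimately show ?case by simp
    qed
    show "\<forall>\<^sub>F R in at_top. card (closed_walks u R) \<le>
        (1 + card (out_arcs G u) * C) * (R + 1) * exp (h * R)"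
      using eventually_ge_at_top[of 0]
    proof eventually_elim
      case (elim R)
      have "card (closed_walks u R) \<le> card (insert [] (?U R))"
        using sub fin[OF elim] by (intro card_mono) auto
      also have "\<dots> \<le> 1 + card (?U R)" using card_insert_le_m1 fin[OF elim] by (simp add: card_insert_if)
      also have "card (?U R) \<le> (\<Sum>a\<in>out_arcs G u. card ((#) a ` nbw.short_continuations a R))"
        by (intro card_UN_le) auto
      also have "\<dots> \<le> (\<Sum>a\<in>out_arcs G u. card (nbw.short_continuations a R))"
        using C elim by (intro sum_mono card_image_le) auto
      finally have "real (card (closed_walks u R)) \<le>
          1 + (\<Sum>a\<in>out_arcs G u. real (card (nbw.short_continuations a R)))"
        by (simp flip: of_nat_sum of_nat_Suc)
      also have "\<dots> \<le> 1 + (\<Sum>a\<in>out_arcs G u. C * (R + 1) * exp (h * R))"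
        using C elim by (intro add_left_mono sum_mono) auto
      also have "\<dots> \<le> (R + 1) * exp (h * R) + (\<Sum>a\<in>out_arcs G u. C * (R + 1) * exp (h * R))"
      proof (rule add_right_mono)
        have "1 * 1 \<le> (R + 1) * exp (h * R)" using elim h0 by (intro mult_mono) auto
        then show "1 \<le> (R + 1) * exp (h * R)" by simp
      qed
      also have "\<dots> = (1 + card (out_arcs G u) * C) * (R + 1) * exp (h * R)"
        by (simp add: algebra_simps)
      finally show ?case .
    qed
  qed (use c C0 in \<open>auto intro!: add_pos_nonneg\<close>)
qed

theorem volume_entropy_eqI:
  assumes h: "nbw.harmonic h x"
  shows "volume_entropy (G, arev, L) = h"
  unfolding volume_entropy_def prod.case
proof (rule the_equality)
  have lim: "((\<lambda>R::real. ln (real (card {g \<in> carrier (fundamental_group G arev v).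
      cover_dist G arev L v x (deck_action arev g x) \<le> ereal R})) / R) \<longlongrightarrow> h) at_top"
    if "v \<in> verts G" "x \<in> verts (universal_cover G arev v)" for v x
  proof -
    from that obtain u where u: "awalk v x u" "reduced arev x" by (auto simp: cover_simps)
    show ?thesis
      unfolding card_orbit_ball[OF u] by (rule closed_walks_growth[OF h awalk_last_in_verts[OF u(1)]])
  qed
  then show "\<forall>v\<in>verts G. \<forall>x\<in>verts (universal_cover G arev v).
     ((\<lambda>R::real. ln (real (card {g \<in> carrier (fundamental_group G arev v).
             cover_dist G arev L v x (deck_action arev g x) \<le> ereal R})) / R) \<longlongrightarrow> h) at_top"
    by blast
  fix h' assume h': "\<forall>v\<in>verts G. \<forall>x\<in>verts (universal_cover G arev v).
     ((\<lambda>R::real. ln (real (card {g \<in> carrier (fundamental_group G arev v).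
             cover_dist G arev L v x (deck_action arev g x) \<le> ereal R})) / R) \<longlongrightarrow> h') at_top"
  obtain v where v: "v \<in> verts G" using verts_nonempty by blast
  then have base: "[] \<in> verts (universal_cover G arev v)" by (auto simp: cover_simps awalk_Nil_iff)
  show "h' = h"
    by (rule tendsto_unique[OF trivial_limit_at_top_linorder h'[rule_format, OF v base] lim[OF v base]])
qed

theorem ex_harmonic_entropy: "\<exists>x. nbw.harmonic (volume_entropy (G, arev, L)) x"
proof -
  obtain x where x: "nbw.harmonic nbw.critical_exponent x" using nbw.ex_harmonic_critical by blast
  then show ?thesis using volume_entropy_eqI[OF x] by auto
qed

end

section \<open>The lower bound and its equality case\<close>

text \<open>
  The second factor on the left is the contribution of a vertex of degree \<open>d\<close> to \<open>-2\<close> times the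
  Euler characteristic.  From \<open>d = 9\<close> on, \<open>ln (d - 1) \<ge> ln 8\<close> suffices; the remaining cases are
  comparisons of powers of integers.
\<close>

lemma degree_inequality:
  assumes "3 \<le> d"
  shows "3 * (real d - 2) * ln 2 \<le> d * ln (real d - 1)"
    and "d \<noteq> 3 \<Longrightarrow> 3 * (real d - 2) * ln 2 < d * ln (real d - 1)"
proof -
  show strict: "3 * (real d - 2) * ln 2 < d * ln (real d - 1)" if "d \<noteq> 3"
  proof (cases "d \<le> 8")
    case True
    then have "d \<in> {4, 5, 6, 7, 8}" using assms that by auto
    then have "(2 :: real) ^ (3 * (d - 2)) < (real d - 1) ^ d" by auto
    moreover have "0 < (real d - 1) ^ d" using assms by simp
    ultimately have "ln ((2 :: real) ^ (3 * (d - 2))) < ln ((real d - 1) ^ d)"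
      by (subst ln_less_cancel_iff) auto
    then show ?thesis using assms by (simp add: ln_realpow of_nat_diff)
  next
    case False
    have "3 * (real d - 2) * ln 2 < real d * (3 * ln 2)" by simp
    also have "3 * ln 2 = ln (2 ^ 3 :: real)" by (subst ln_realpow) auto
    also have "real d * ln (2 ^ 3) \<le> real d * ln (real d - 1)" using False by simp
    finally show ?thesis .
  qed
  show "3 * (real d - 2) * ln 2 \<le> d * ln (real d - 1)"
  proof (cases "d = 3")
    case True
    then show ?thesis by simp
  qed (use strict in simp)
qed

context metric_graph_min_degree_3
begin

lemma sum_arcs_by_head: "(\<Sum>a\<in>arcs G. f (head G a)) = (\<Sum>u\<in>verts G. real (out_degree G u) * f u)"
proof -
  have "(\<Sum>a\<in>arcs G. f (head G a)) = (\<Sum>u\<in>verts G. \<Sum>a\<in>{a \<in> arcs G. head G a = u}. f (head G a))"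
    by (rule sum.group[symmetric]) auto
  also have "\<dots> = (\<Sum>u\<in>verts G. real (card (in_arcs G u)) * f u)"
    by (intro sum.cong) (auto simp: in_arcs_def)
  also have "\<dots> = (\<Sum>u\<in>verts G. real (out_degree G u) * f u)"
    unfolding in_arcs_eq out_degree_def card_image[OF inj_on_arev] ..
  finally show ?thesis .
qed

lemma card_arcs_eq: "real (card (arcs G)) = (\<Sum>u\<in>verts G. real (out_degree G u))"
  using sum_arcs_by_head[of "\<lambda>_. 1"] by simp

lemma sum_log_turns:
  "(\<Sum>a\<in>arcs G. ln (card (turns a))) = (\<Sum>u\<in>verts G. out_degree G u * ln (real (out_degree G u) - 1))"
proof -
  have "(\<Sum>a\<in>arcs G. ln (card (turns a))) = (\<Sum>a\<in>arcs G. ln (real (out_degree G (head G a)) - 1))"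
  proof (rule sum.cong)
    fix a assume a: "a \<in> arcs G"
    have "3 \<le> out_degree G (head G a)" using a min_degree by simp
    then show "ln (real (card (turns a))) = ln (real (out_degree G (head G a)) - 1)"
      using card_turns[OF a] by (simp add: of_nat_diff)
  qed simp
  then show ?thesis using sum_arcs_by_head[of "\<lambda>u. ln (real (out_degree G u) - 1)"] by simp
qed

lemma sum_degree_bound:
  assumes "card (arcs G) + 2 = 2 * card (verts G) + 2 * k"
  shows "(\<Sum>u\<in>verts G. 3 * (real (out_degree G u) - 2) * ln 2) = 2 * ((3 * real k - 3) * ln 2)"
proof -
  have "(\<Sum>u\<in>verts G. 3 * (real (out_degree G u) - 2) * ln 2) =
      3 * ln 2 * (\<Sum>u\<in>verts G. real (out_degree G u) - 2)"
    by (subst sum_distrib_left) (rule sum.cong, simp_all)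
  also have "(\<Sum>u\<in>verts G. real (out_degree G u) - 2) = real (card (arcs G)) - 2 * card (verts G)"
    using card_arcs_eq by (simp add: sum_subtractf)
  also have "\<dots> = 2 * real k - 2" using assms by linarith
  finally show ?thesis by (simp add: algebra_simps)
qed

lemma sum_log_le_entropy:
  assumes "volume G L = 1"
  shows "(\<Sum>a\<in>arcs G. ln (card (turns a))) \<le> 2 * volume_entropy (G, arev, L)"
proof -
  obtain x where x: "nbw.harmonic (volume_entropy (G, arev, L)) x" using ex_harmonic_entropy by blast
  show ?thesis using nbw.harmonic_log_average(1)[OF x turns_stochastic] assms by (simp add: volume_def)
qed

theorem entropy_lower_bound:
  assumes k: "card (arcs G) + 2 = 2 * card (verts G) + 2 * k" and vol: "volume G L = 1"
  shows "(3 * real k - 3) * ln 2 \<le> volume_entropy (G, arev, L)"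
proof -
  have "2 * ((3 * real k - 3) * ln 2) \<le> (\<Sum>a\<in>arcs G. ln (card (turns a)))"
    unfolding sum_degree_bound[OF k, symmetric] sum_log_turns
    using degree_inequality(1)[OF min_degree] by (intro sum_mono) auto
  then show ?thesis using sum_log_le_entropy[OF vol] by simp
qed

text \<open>
  At each vertex any two outgoing arcs are turns of the inverse of a third one, so that the weight
  \<open>exp (- h * L b) * x b\<close> depends only on the tail of \<open>b\<close>.  Hence the equation also holds with the
  inverse \<open>arev a\<close> in place of \<open>b\<close>, although this is not a turn, and applying it to \<open>a\<close> and to \<open>arev a\<close>
  eliminates \<open>x\<close>.
\<close>

lemma equal_weights_imp_length:
  assumes h: "nbw.harmonic h x" and card: "\<And>a. a \<in> arcs G \<Longrightarrow> card (turns a) = q"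
    and eq: "\<And>a b. a \<in> arcs G \<Longrightarrow> b \<in> turns a \<Longrightarrow> exp (- (h * L b)) * x b * q = x a"
    and a: "a \<in> arcs G"
  shows "exp (h * L a) = q"
proof -
  have rev: "exp (- (h * L a)) * x (arev a) * q = x a" if a: "a \<in> arcs G" for a
  proof -
    obtain b where b: "b \<in> turns a" using turns_nonempty[OF a] by blast
    then have ba: "b \<in> arcs G" "tail G b = head G a" "b \<noteq> arev a" by (auto simp: turns_def)
    obtain c where c: "c \<in> out_arcs G (head G a)" "c \<noteq> b" "c \<noteq> arev a"
      using third_arc[of "head G a" b "arev a"] a by auto
    have "b \<in> turns (arev c)" "arev a \<in> turns (arev c)" "arev c \<in> arcs G"
      using ba c a by (auto simp: turns_def)
    then have "exp (- (h * L (arev a))) * x (arev a) * q = exp (- (h * L b)) * x b * q"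
      using eq by metis
    then show ?thesis using eq[OF a b] L_arev[OF a] by simp
  qed
  have x: "0 < x a" using h a by (auto simp: nbw.harmonic_def)
  let ?e = "exp (- (h * L a)) * q"
  have "?e * x (arev a) = x a" "?e * x a = x (arev a)"
    using rev[OF a] rev[of "arev a"] a L_arev[OF a] by (simp_all add: mult_ac)
  then have "?e * ?e * x a = 1 * x a" by (simp add: mult.assoc)
  then have "?e * ?e = 1" using x by (simp only: mult_right_cancel)
  moreover have "0 \<le> ?e" by simp
  ultimately have "?e = 1" by (simp add: square_eq_1_iff)
  then show ?thesis by (simp add: exp_minus field_simps)
qed

theorem entropy_minimal_imp_regular:
  assumes k: "card (arcs G) + 2 = 2 * card (verts G) + 2 * k" and vol: "volume G L = 1"
    and min: "volume_entropy (G, arev, L) = (3 * real k - 3) * ln 2"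
  shows "trivalent G" and "a \<in> arcs G \<Longrightarrow> b \<in> arcs G \<Longrightarrow> L a = L b"
proof -
  let ?h = "volume_entropy (G, arev, L)"
  have "(\<Sum>u\<in>verts G. 3 * (real (out_degree G u) - 2) * ln 2) = 2 * ?h"
    using sum_degree_bound[OF k] min by simp
  moreover have "\<not> (\<Sum>u\<in>verts G. 3 * (real (out_degree G u) - 2) * ln 2)
      < (\<Sum>u\<in>verts G. out_degree G u * ln (real (out_degree G u) - 1))"
    using sum_log_le_entropy[OF vol] calculation unfolding sum_log_turns by simp
  ultimately have no_strict: "\<not> (\<exists>u\<in>verts G. out_degree G u \<noteq> 3)"
    using sum_strict_mono_ex1[OF finite_verts, of "\<lambda>u. 3 * (real (out_degree G u) - 2) * ln 2"
        "\<lambda>u. out_degree G u * ln (real (out_degree G u) - 1)"] degree_inequality[OF min_degree]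
    by blast
  then show "trivalent G" by (simp add: trivalent_def)
  have two: "card (turns a) = 2" if "a \<in> arcs G" for a using card_turns[OF that] no_strict that by simp
  obtain x where x: "nbw.harmonic ?h x" using ex_harmonic_entropy by blast
  have "(\<Sum>a\<in>arcs G. ln (card (turns a))) = 2 * ((3 * real k - 3) * ln 2)"
    unfolding sum_log_turns sum_degree_bound[OF k, symmetric] using no_strict
    by (intro sum.cong) auto
  then have eq: "(\<Sum>a\<in>arcs G. ln (card (turns a))) = ?h * (\<Sum>a\<in>arcs G. L a)"
    using min vol by (simp add: volume_def)
  have "exp (?h * L a) = 2" if "a \<in> arcs G" for a
    using equal_weights_imp_length[OF x two _ that] two
      nbw.harmonic_log_average(2)[OF x turns_stochastic eq] by simp
  then have hL: "?h * L a = ln 2" if "a \<in> arcs G" for a using that by (metis ln_exp)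
  assume a: "a \<in> arcs G" and b: "b \<in> arcs G"
  have "?h \<noteq> 0" using hL[OF a] by auto
  then show "L a = L b" using hL[OF a] hL[OF b] by (metis mult_left_cancel)
qed

theorem entropy_regular_trivalent:
  assumes "trivalent G" and "0 < l" and "\<And>a. a \<in> arcs G \<Longrightarrow> L a = l"
  shows "volume_entropy (G, arev, L) = ln 2 / l"
proof (rule volume_entropy_eqI)
  have "nbw.transfer (ln 2 / l) (\<lambda>_. 1) a = 1" if a: "a \<in> arcs G" for a
  proof -
    have "nbw.transfer (ln 2 / l) (\<lambda>_. 1) a = (\<Sum>b\<in>turns a. 1 / 2)"
      unfolding nbw.transfer_def
    proof (rule sum.cong)
      fix b assume "b \<in> turns a"
      then have "L b = l" using assms(3) turns_subset by blast
      then show "exp (- (ln 2 / l * L b)) * 1 = 1 / 2" using assms(2) by (simp add: exp_minus)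
    qed simp
    also have "\<dots> = 1" using card_turns[OF a] assms(1) a by (simp add: trivalent_def)
    finally show ?thesis .
  qed
  then show "nbw.harmonic (ln 2 / l) (\<lambda>_. 1)" by (simp add: nbw.harmonic_def)
qed

text \<open>
  Only the turns from \<open>a\<close> into itself and into \<open>b\<close>, and from \<open>b\<close> into \<open>a\<close>, are kept in the eigenvalue
  equation.  They give \<open>1 - exp (- h * L a) \<ge> exp (- h * (L a + L b))\<close>, so that a short
  loop \<open>a\<close> forces \<open>h\<close> to be large.
\<close>

lemma entropy_loops:
  assumes a: "a \<in> arcs G" "head G a = tail G a" and b: "b \<in> arcs G" "head G b = tail G b"
    and ab: "tail G a = tail G b" "b \<noteq> a" "b \<noteq> arev a"
  shows "exp (- (volume_entropy (G, arev, L) * (L a + L b))) \<le> volume_entropy (G, arev, L) * L a"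
proof -
  let ?h = "volume_entropy (G, arev, L)"
  obtain x where x: "nbw.harmonic ?h x" using ex_harmonic_entropy by blast
  have pos: "0 < x c" "nbw.transfer ?h x c = x c" if "c \<in> arcs G" for c
    using x that by (auto simp: nbw.harmonic_def)
  have turns: "{a, b} \<subseteq> turns a" "a \<in> turns b"
    using a b ab arev_neq[OF a(1)] by (auto simp: turns_def)
  have "exp (- (?h * L a)) * x a + exp (- (?h * L b)) * x b =
      (\<Sum>c\<in>{a, b}. exp (- (?h * L c)) * x c)" using ab(2) by simp
  also have "\<dots> \<le> nbw.transfer ?h x a"
    unfolding nbw.transfer_def using turns nbw.finite_succ[OF a(1)] turns_subset pos(1)
    by (intro sum_mono2) (auto simp: less_imp_le subset_iff)
  finally have 1: "exp (- (?h * L a)) * x a + exp (- (?h * L b)) * x b \<le> x a" using pos a by simp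
  have "exp (- (?h * L a)) * x a \<le> nbw.transfer ?h x b"
    using pos(1) by (intro nbw.transfer_ge b turns) (auto simp: less_imp_le)
  then have 2: "exp (- (?h * L a)) * x a \<le> x b" using pos b by simp
  have "exp (- (?h * (L a + L b))) * x a = exp (- (?h * L b)) * (exp (- (?h * L a)) * x a)"
    by (simp add: exp_add[symmetric] algebra_simps flip: mult.assoc)
  also have "\<dots> \<le> exp (- (?h * L b)) * x b" using 2 by (intro mult_left_mono) auto
  also have "\<dots> \<le> (1 - exp (- (?h * L a))) * x a" using 1 by (simp add: algebra_simps)
  finally have "exp (- (?h * (L a + L b))) \<le> 1 - exp (- (?h * L a))"
    using pos(1)[OF a(1)] by (simp only: mult_le_cancel_right)
  also have "\<dots> \<le> ?h * L a" using exp_ge_add_one_self[of "- (?h * L a)"] by simp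
  finally show ?thesis .
qed

end

section \<open>Points of the moduli space\<close>

lemma finite_connected_bidirected_graphI:
  "finite_connected_graph G arev \<Longrightarrow> finite_connected_bidirected_graph G arev"
  unfolding finite_connected_graph_def finite_connected_bidirected_graph_def finite_connected_bidirected_graph_axioms_def by blast

text \<open>
  Degree zero is excluded by connectedness: the graph would be a single vertex, whose fundamental
  group is trivial.
\<close>

lemma moduli_space_min_degree_3:
  assumes F: "free_group_of_rank F k" and k: "2 \<le> k" and M: "(G, arev, L) \<in> moduli_space F"
  shows "metric_graph_min_degree_3 G arev L"
    and "card (arcs G) + 2 = 2 * card (verts G) + 2 * k"
proof -
  have M': "finite_connected_graph G arev" "has_fundamental_group G arev F" "metric_structure G arev L"
    "\<And>u. u \<in> verts G \<Longrightarrow> out_degree G u \<noteq> 1 \<and> out_degree G u \<noteq> 2"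
    using M by (auto simp: moduli_space_def)
  interpret finite_connected_bidirected_graph G arev using M'(1) by (rule finite_connected_bidirected_graphI)
  show card: "card (arcs G) + 2 = 2 * card (verts G) + 2 * k"
    using has_fundamental_group_iff[OF F] M'(2) by simp
  have "out_degree G u \<noteq> 0" if u: "u \<in> verts G" for u
  proof
    assume "out_degree G u = 0"
    then have "out_arcs G u = {}" unfolding out_degree_def using finite_out_arcs by (simp add: card_eq_0_iff)
    then have no_arc: "tail G a \<noteq> u" if "a \<in> arcs G" for a using that by auto
    have "{u} = verts G"
      by (rule closed_vertex_set) (use u no_arc in auto)
    then have "arcs G = {}" using no_arc tail_in_verts by blast
    then show False using card k by simp
  qed
  then have "3 \<le> out_degree G u" if "u \<in> verts G" for u
    using M'(4)[OF that] that by (metis One_nat_def less_2_cases not_less_eq_eq numeral_2_eq_2 numeral_3_eq_3 le_antisym linorder_not_le not_less_eq)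
  then show "metric_graph_min_degree_3 G arev L"
    using M'(3) by unfold_locales auto
qed

subsection \<open>Graphs from combinatorial data\<close>

text \<open>
  Arcs and vertices are described by convenient index types and then carried to arbitrary infinite
  types by injections \<open>f\<close> and \<open>g\<close>.  The index \<open>r i\<close> belongs to the inverse of the arc with index \<open>i\<close>,
  so that only tails have to be given.
\<close>

definition indexed_graph ::
    "('a \<Rightarrow> 'e) \<Rightarrow> ('b \<Rightarrow> 'v) \<Rightarrow> 'a set \<Rightarrow> 'b set \<Rightarrow> ('a \<Rightarrow> 'b) \<Rightarrow> ('a \<Rightarrow> 'a) \<Rightarrow> ('v, 'e) pre_digraph" where
  "indexed_graph f g I V t r =
     \<lparr>verts = g ` V, arcs = f ` I, tail = g \<circ> t \<circ> inv_into UNIV f, head = g \<circ> t \<circ> r \<circ> inv_into UNIV f\<rparr>"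

definition indexed_rev :: "('a \<Rightarrow> 'e) \<Rightarrow> 'a set \<Rightarrow> ('a \<Rightarrow> 'a) \<Rightarrow> 'e \<Rightarrow> 'e" where
  "indexed_rev f I r e = (if e \<in> f ` I then f (r (inv_into UNIV f e)) else e)"

locale combinatorial_graph =
  fixes f :: "'a \<Rightarrow> 'e" and g :: "'b \<Rightarrow> 'v" and I :: "'a set" and V :: "'b set"
    and t :: "'a \<Rightarrow> 'b" and r :: "'a \<Rightarrow> 'a"
  assumes inj_f: "inj f" and inj_g: "inj g"
    and finite_I: "finite I" and finite_V: "finite V" and V_nonempty: "V \<noteq> {}"
    and t_V: "\<And>i. i \<in> I \<Longrightarrow> t i \<in> V"
    and r_I: "\<And>i. i \<in> I \<Longrightarrow> r i \<in> I" and r_r: "\<And>i. i \<in> I \<Longrightarrow> r (r i) = i"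
    and r_ne: "\<And>i. i \<in> I \<Longrightarrow> r i \<noteq> i"
    and closed: "\<And>S. S \<subseteq> V \<Longrightarrow> S \<noteq> {} \<Longrightarrow> (\<And>i. i \<in> I \<Longrightarrow> t i \<in> S \<Longrightarrow> t (r i) \<in> S) \<Longrightarrow> S = V"
begin

abbreviation "realization \<equiv> indexed_graph f g I V t r"
abbreviation "realization_rev \<equiv> indexed_rev f I r"

lemma indexed_simps [simp]:
  "verts realization = g ` V" "arcs realization = f ` I"
  "tail realization (f i) = g (t i)" "head realization (f i) = g (t (r i))"
  "i \<in> I \<Longrightarrow> realization_rev (f i) = f (r i)"
  using inj_f by (simp_all add: indexed_graph_def indexed_rev_def)

lemma card_indexed: "card (verts realization) = card V" "card (arcs realization) = card I"
  using inj_f inj_g by (simp_all add: card_image inj_on_subset[OF _ subset_UNIV])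

lemma out_degree_indexed: "out_degree realization (g v) = card {i \<in> I. t i = v}"
proof -
  have "out_arcs realization (g v) = f ` {i \<in> I. t i = v}"
    using inj_g by (auto simp: out_arcs_def inj_eq)
  then show ?thesis
    using inj_f by (simp add: out_degree_def card_image inj_on_subset[OF _ subset_UNIV])
qed

lemma finite_connected: "finite_connected_graph realization realization_rev"
  unfolding finite_connected_graph_def
proof (intro conjI)
  interpret wf_digraph realization
    by unfold_locales (auto simp: t_V r_I)
  show "fin_digraph realization"
    by unfold_locales (simp_all add: finite_I finite_V)
  show "bidirected_digraph realization realization_rev"
  proof (rule bidirected_digraphI)
    show "realization_rev a = a" if "a \<notin> arcs realization" for a
      using that by (simp add: indexed_rev_def indexed_graph_def)
  qed (use inj_f in \<open>auto simp: r_I r_r r_ne inj_eq\<close>)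
  show "Digraph_Component.connected realization"
  proof (rule connectedI)
    show "verts realization \<noteq> {}" using V_nonempty by simp
    fix u w assume u: "u \<in> verts realization" and w: "w \<in> verts realization"
    let ?S = "{v \<in> V. u \<rightarrow>\<^sup>*\<^bsub>realization\<^esub> g v}"
    have "?S = V"
    proof (rule closed)
      show "?S \<noteq> {}" using u by auto
      fix i assume i: "i \<in> I" "t i \<in> ?S"
      have "g (t i) \<rightarrow>\<^bsub>realization\<^esub> g (t (r i))"
        using i by (intro dominatesI[of "f i"]) (auto simp: arc_to_ends_def)
      then show "t (r i) \<in> ?S" using i t_V r_I reachable_adj_trans by blast
    qed auto
    then have "u \<rightarrow>\<^sup>*\<^bsub>realization\<^esub> w" using w by auto
    then show "u \<rightarrow>\<^sup>*\<^bsub>with_proj (mk_symmetric realization)\<^esub> w" by (rule reachable_mk_symmetricI)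
  qed
qed

end

lemma ex_inj_of_countable:
  obtains f :: "'c::countable \<Rightarrow> 'd::infinite" where "inj f"
proof -
  obtain h :: "nat \<Rightarrow> 'd" where "inj h"
    using infinite_countable_subset[OF infinite_UNIV] by blast
  then have "inj (h \<circ> to_nat :: 'c \<Rightarrow> 'd)" by (intro inj_compose) simp_all
  then show ?thesis using that by blast
qed

subsection \<open>A trivalent graph of each rank\<close>

text \<open>
  The vertices form a cycle of even length \<open>n\<close>, and the edge from each even vertex to the next one is
  doubled.  At the vertex \<open>i\<close> the arcs \<open>(i, 0)\<close> and \<open>(i, 1)\<close> follow the cycle forwards and backwards,
  and \<open>(i, 2)\<close> is the additional arc.
\<close>

definition necklace_rev :: "nat \<Rightarrow> nat \<times> nat \<Rightarrow> nat \<times> nat" where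
  "necklace_rev n = (\<lambda>(i, c).
     if c = 0 then (Suc i mod n, 1)
     else if c = 1 then ((i + n - 1) mod n, 0)
     else (if even i then Suc i else i - 1, 2))"

lemma necklace:
  assumes f: "inj f" and g: "inj g" and m: "1 \<le> m"
  shows "combinatorial_graph f g ({..<2 * m} \<times> {..<3}) {..<2 * m} fst (necklace_rev (2 * m))"
proof
  let ?n = "2 * m" and ?I = "{..<2 * m} \<times> {..<3 :: nat}"
  have n: "2 \<le> ?n" using m by simp
  have succ_pred: "(Suc i mod ?n + ?n - 1) mod ?n = i" if "i < ?n" for i
    using that n by (cases "Suc i = ?n") (auto simp: mod_Suc)
  have pred_succ: "Suc ((i + ?n - 1) mod ?n) mod ?n = i" if "i < ?n" for i
    using that n by (cases i) (auto simp: mod_Suc)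
  show "necklace_rev ?n a \<in> ?I" if "a \<in> ?I" for a
  proof (cases a)
    case (Pair i c)
    have "Suc i < ?n" if "even i" using that \<open>a \<in> ?I\<close> Pair by (auto elim!: evenE)
    then show ?thesis using that Pair n by (auto simp: necklace_rev_def)
  qed
  show "necklace_rev ?n (necklace_rev ?n a) = a" if "a \<in> ?I" for a
  proof (cases a)
    case (Pair i c)
    then show ?thesis
      using that succ_pred[of i] pred_succ[of i] by (auto simp: necklace_rev_def elim: oddE)
  qed
  show "necklace_rev ?n a \<noteq> a" if "a \<in> ?I" for a
    using that by (cases a) (auto simp: necklace_rev_def elim!: oddE)
  fix S assume S: "S \<subseteq> {..<?n}" "S \<noteq> {}" and closed:
    "\<And>a. a \<in> ?I \<Longrightarrow> fst a \<in> S \<Longrightarrow> fst (necklace_rev ?n a) \<in> S"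
  obtain i where i: "i \<in> S" using S by blast
  have step: "Suc j mod ?n \<in> S" if "j \<in> S" for j
    using closed[of "(j, 0)"] that S(1) by (auto simp: necklace_rev_def)
  have reach: "(i + j) mod ?n \<in> S" for j
  proof (induction j)
    case 0
    then show ?case using i S(1) by auto
  next
    case (Suc j)
    then show ?case using step[OF Suc] by (simp add: mod_Suc_eq)
  qed
  have "w \<in> S" if "w < ?n" for w
  proof -
    have "i + (w + ?n - i) = w + ?n" using i S(1) by auto
    then show ?thesis using reach[of "w + ?n - i"] that by simp
  qed
  then show "S = {..<?n}" using S(1) by blast
qed (use assms in \<open>auto simp: lessThan_empty_iff\<close>)

lemma ex_trivalent_graph:
  assumes F: "free_group_of_rank F k" and k: "2 \<le> k"
  obtains G :: "('v::infinite, 'e::infinite) pre_digraph" and arev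
  where "finite_connected_graph G arev" "trivalent G" "has_fundamental_group G arev F"
proof -
  define m where "m = k - 1"
  have m: "1 \<le> m" "k = Suc m" using k by (simp_all add: m_def)
  obtain f :: "nat \<times> nat \<Rightarrow> 'e" where f: "inj f" by (rule ex_inj_of_countable)
  obtain g :: "nat \<Rightarrow> 'v" where g: "inj g" by (rule ex_inj_of_countable)
  interpret combinatorial_graph f g "{..<2 * m} \<times> {..<3}" "{..<2 * m}" fst "necklace_rev (2 * m)"
    by (rule necklace[OF f g m(1)])
  interpret finite_connected_bidirected_graph realization realization_rev by (rule finite_connected_bidirected_graphI[OF finite_connected])
  have "trivalent realization"
    unfolding trivalent_def
  proof
    fix u assume "u \<in> verts realization"
    then obtain v where v: "v < 2 * m" "u = g v" by auto
    have "{i \<in> {..<2 * m} \<times> {..<3 :: nat}. fst i = v} = {v} \<times> {..<3}" using v by auto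
    then show "out_degree realization u = 3" unfolding v(2) out_degree_indexed by (simp add: card_cartesian_product)
  qed
  moreover have "has_fundamental_group realization realization_rev F"
    unfolding has_fundamental_group_iff[OF F] card_indexed by (simp add: m card_cartesian_product)
  ultimately show ?thesis using that finite_connected by blast
qed

subsection \<open>A rose with a short petal\<close>

lemma rose:
  fixes k :: nat
  assumes f: "inj f" and g: "inj g"
  shows "combinatorial_graph f g ({..<k} \<times> (UNIV :: bool set)) {0 :: nat} (\<lambda>_. 0) (\<lambda>(i, s). (i, \<not> s))"
  by unfold_locales (use assms in auto)

lemma ex_large_entropy:
  assumes F: "free_group_of_rank F k" and k: "2 \<le> k"
  shows "\<exists>P \<in> (moduli_space F :: ('v::infinite, 'e::infinite) metric_graph set). C < volume_entropy P"
proof -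
  obtain f :: "nat \<times> bool \<Rightarrow> 'e" where f: "inj f" by (rule ex_inj_of_countable)
  obtain g :: "nat \<Rightarrow> 'v" where g: "inj g" by (rule ex_inj_of_countable)
  interpret combinatorial_graph f g "{..<k} \<times> UNIV" "{0}" "\<lambda>_. 0" "\<lambda>(i, s). (i, \<not> s)"
    by (rule rose[OF f g])
  interpret finite_connected_bidirected_graph realization realization_rev by (rule finite_connected_bidirected_graphI[OF finite_connected])
  define D where "D = max C 1"
  have D: "0 < D" "C \<le> D" by (auto simp: D_def)
  \<comment> \<open>Small enough to contradict \<open>entropy_loops\<close> if the entropy is at most \<open>D\<close>.\<close>
  define \<epsilon> where "\<epsilon> = exp (- D) / (D + 1)"
  have "exp (- D) < 1" using D by simp
  then have "exp (- D) < D + 1" using D by linarith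
  then have \<epsilon>: "0 < \<epsilon>" "\<epsilon> < 1" using D by (simp_all add: \<epsilon>_def)
  have "D * \<epsilon> = exp (- D) * (D / (D + 1))" by (simp add: \<epsilon>_def)
  also have "\<dots> < exp (- D) * 1" using D by (intro mult_strict_left_mono) auto
  finally have D\<epsilon>: "D * \<epsilon> < exp (- D)" by simp
  define L where "L e = (if fst (inv_into UNIV f e) = 0 then \<epsilon> else (1 - \<epsilon>) / (real k - 1))" for e
  have Lf: "L (f (i, s)) = (if i = 0 then \<epsilon> else (1 - \<epsilon>) / (real k - 1))" for i s
    using f by (simp add: L_def)
  have deg: "out_degree realization (g 0) = 2 * k"
    unfolding out_degree_indexed by (simp add: card_cartesian_product)
  have vol: "volume realization L = 1"
  proof -
    have "(\<Sum>e\<in>arcs realization. L e) = (\<Sum>(i, s)\<in>{..<k} \<times> UNIV. L (f (i, s)))"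
      unfolding indexed_simps
      by (subst sum.reindex[OF inj_on_subset[OF f subset_UNIV]]) (auto intro!: sum.cong)
    also have "\<dots> = (\<Sum>i<k. \<Sum>s\<in>(UNIV :: bool set). L (f (i, s)))"
      by (rule sum.cartesian_product[symmetric])
    also have "\<dots> = 2 * (\<Sum>i<k. if i = 0 then \<epsilon> else (1 - \<epsilon>) / (real k - 1))"
      by (simp add: Lf sum_distrib_left)
    also have "(\<Sum>i<k. if i = 0 then \<epsilon> else (1 - \<epsilon>) / (real k - 1)) =
        \<epsilon> + (\<Sum>i\<in>{..<k} - {0}. (1 - \<epsilon>) / (real k - 1))"
      using k by (subst sum.remove[of _ 0]) auto
    also have "\<dots> = 1" using k by (simp add: of_nat_diff)
    finally show ?thesis by (simp add: volume_def)
  qed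
  have M: "(realization, realization_rev, L) \<in> moduli_space F"
    unfolding moduli_space_def
  proof (intro CollectI case_prodI conjI)
    show "finite_connected_graph realization realization_rev" by (rule finite_connected)
    show "\<forall>v\<in>verts realization. out_degree realization v \<noteq> 1 \<and> out_degree realization v \<noteq> 2"
      using deg k by simp
    show "has_fundamental_group realization realization_rev F"
      unfolding has_fundamental_group_iff[OF F] card_indexed by (simp add: card_cartesian_product)
    show "metric_structure realization realization_rev L"
      using \<epsilon> k by (auto simp: metric_structure_def Lf)
    show "volume realization L = 1" by (rule vol)
  qed
  interpret metric_graph_min_degree_3 realization realization_rev L
    by (rule moduli_space_min_degree_3(1)[OF F k M])
  let ?h = "volume_entropy (realization, realization_rev, L)" and ?a = "f (0, True)" and ?b = "f (1, True)"
  have loops: "exp (- (?h * (L ?a + L ?b))) \<le> ?h * L ?a"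
    using k f by (intro entropy_loops) (auto simp: inj_eq)
  have "(1 - \<epsilon>) / (real k - 1) \<le> (1 - \<epsilon>) / 1" using k \<epsilon> by (intro divide_left_mono) auto
  then have "L ?a = \<epsilon>" "L ?a + L ?b \<le> 1" by (simp_all add: Lf)
  have "D < ?h"
  proof (rule ccontr)
    assume "\<not> D < ?h"
    moreover obtain x where "nbw.harmonic ?h x" using ex_harmonic_entropy by blast
    then have h0: "0 \<le> ?h" by (rule nbw.harmonic_imp_nonneg)
    ultimately have "?h * (L ?a + L ?b) \<le> D * 1"
      using \<open>L ?a + L ?b \<le> 1\<close> \<epsilon> D k by (intro mult_mono) (auto simp: Lf)
    then have "exp (- D) \<le> exp (- (?h * (L ?a + L ?b)))" by simp
    also have "\<dots> \<le> ?h * \<epsilon>" using loops \<open>L ?a = \<epsilon>\<close> by simp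
    also have "\<dots> \<le> D * \<epsilon>" using \<open>\<not> D < ?h\<close> \<epsilon> by (intro mult_right_mono) auto
    finally show False using D\<epsilon> by simp
  qed
  then show ?thesis using M D by force
qed

section \<open>Minimal volume entropy\<close>

lemma regular_trivalent_point:
  fixes G :: "('v, 'e) pre_digraph"
  assumes F: "free_group_of_rank F k" and k: "2 \<le> k"
    and G: "finite_connected_graph G arev" "trivalent G" "has_fundamental_group G arev F"
    and L: "\<forall>a\<in>arcs G. L a = 1 / (3 * real k - 3)"
  shows "card (nonoriented_edges G arev) = 3 * k - 3"
    and "(G, arev, L) \<in> moduli_space F"
    and "volume_entropy (G, arev, L) = (3 * real k - 3) * ln 2"
proof -
  interpret finite_connected_bidirected_graph G arev using G(1) by (rule finite_connected_bidirected_graphI)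
  have pos: "0 < 3 * real k - 3" using k by simp
  have metric: "metric_structure G arev L"
    using L pos by (simp add: metric_structure_def)
  interpret metric_graph_min_degree_3 G arev L
    using metric G(2) by unfold_locales (auto simp: trivalent_def)
  have "real (card (arcs G)) = 3 * card (verts G)"
    using card_arcs_eq G(2) by (simp add: trivalent_def)
  moreover have "card (arcs G) + 2 = 2 * card (verts G) + 2 * k"
    using has_fundamental_group_iff[OF F] G(3) by simp
  ultimately have card: "card (arcs G) = 2 * (3 * k - 3)" using k by linarith
  have "arev ` arcs G \<subseteq> arcs G" by auto
  then obtain P where P: "P \<subseteq> arcs G" "P \<inter> arev ` P = {}" "P \<union> arev ` P = arcs G"
    "card (arcs G) = 2 * card P"
    using ex_orientation[OF subset_refl] by metis
  have "nonoriented_edges G arev = (\<lambda>a. {a, arev a}) ` P"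
    unfolding nonoriented_edges_def P(3)[symmetric] by (auto simp: image_Un insert_commute)
  moreover have "inj_on (\<lambda>a. {a, arev a}) P"
    using P(2) by (auto simp: inj_on_def doubleton_eq_iff)
  ultimately show "card (nonoriented_edges G arev) = 3 * k - 3"
    using card P(4) by (simp add: card_image)
  have "volume G L = 1"
    using L card k by (simp add: volume_def of_nat_diff)
  then show "(G, arev, L) \<in> moduli_space F"
    using G metric by (simp add: moduli_space_def trivalent_def)
  show "volume_entropy (G, arev, L) = (3 * real k - 3) * ln 2"
    using entropy_regular_trivalent[OF G(2), of "1 / (3 * real k - 3)"] L pos by (simp add: mult.commute)
qed

theorem theorem2:
  fixes F :: "('f, 'm) monoid_scheme" and k :: nat
    and M :: "('v::infinite, 'e::infinite) metric_graph set"
  assumes "free_group_of_rank F k" and "k \<ge> 2" and "M = moduli_space F"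
  shows
    "((\<exists>P\<in>M. volume_entropy P = (3 * real k - 3) * ln 2) \<and>
      (\<forall>P\<in>M. (3 * real k - 3) * ln 2 \<le> volume_entropy P)) \<and>
     (\<forall>(G :: ('v, 'e) pre_digraph) arev L.
        finite_connected_graph G arev \<and> trivalent G \<and> has_fundamental_group G arev F \<and>
        (\<forall>a\<in>arcs G. L a = 1 / (3 * real k - 3)) \<longrightarrow>
        card (nonoriented_edges G arev) = 3 * k - 3 \<and>
        (G, arev, L) \<in> M \<and> volume_entropy (G, arev, L) = (3 * real k - 3) * ln 2) \<and>
     (\<forall>G arev L. is_arg_min volume_entropy (\<lambda>P. P \<in> M) (G, arev, L) \<longrightarrow>
        trivalent G \<and> (\<forall>a\<in>arcs G. \<forall>b\<in>arcs G. L a = L b)) \<and>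
     (SUP P\<in>M. ereal (volume_entropy P)) = \<infinity>"
proof -
  note F = assms(1) and k = assms(2) and M = assms(3)
  let ?min = "(3 * real k - 3) * ln 2"
  have regular: "card (nonoriented_edges G arev) = 3 * k - 3 \<and>
        (G, arev, L) \<in> M \<and> volume_entropy (G, arev, L) = ?min"
    if "finite_connected_graph G arev" "trivalent G" "has_fundamental_group G arev F"
      "\<forall>a\<in>arcs G. L a = 1 / (3 * real k - 3)"
    for G :: "('v, 'e) pre_digraph" and arev L
    using regular_trivalent_point[OF F k that] M by simp
  obtain G :: "('v, 'e) pre_digraph" and arev where
    "finite_connected_graph G arev" "trivalent G" "has_fundamental_group G arev F"
    using ex_trivalent_graph[OF F k] .
  then have attained: "\<exists>P\<in>M. volume_entropy P = ?min"
    using regular[of G arev "\<lambda>_. 1 / (3 * real k - 3)"] by blast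
  have point: "?min \<le> volume_entropy (G, arev, L) \<and> (volume_entropy (G, arev, L) = ?min \<longrightarrow>
        trivalent G \<and> (\<forall>a\<in>arcs G. \<forall>b\<in>arcs G. L a = L b))"
    if "(G, arev, L) \<in> M" for G :: "('v, 'e) pre_digraph" and arev L
  proof -
    have mem: "(G, arev, L) \<in> moduli_space F" using that M by simp
    interpret metric_graph_min_degree_3 G arev L by (rule moduli_space_min_degree_3(1)[OF F k mem])
    have card: "card (arcs G) + 2 = 2 * card (verts G) + 2 * k"
      by (rule moduli_space_min_degree_3(2)[OF F k mem])
    have vol: "volume G L = 1" using mem by (simp add: moduli_space_def)
    show ?thesis
      using entropy_lower_bound[OF card vol] entropy_minimal_imp_regular[OF card vol] by blast
  qed
  have "(SUP P\<in>M. ereal (volume_entropy P)) = \<infinity>"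
  proof (rule SUP_PInfty)
    fix n :: nat
    show "\<exists>P\<in>M. ereal (real n) \<le> ereal (volume_entropy P)"
      using ex_large_entropy[OF F k, of "real n"] M by (auto intro: less_imp_le)
  qed
  moreover have "trivalent G \<and> (\<forall>a\<in>arcs G. \<forall>b\<in>arcs G. L a = L b)"
    if "is_arg_min volume_entropy (\<lambda>P. P \<in> M) (G, arev, L)"
    for G :: "('v, 'e) pre_digraph" and arev L
  proof -
    have mem: "(G, arev, L) \<in> M"
      and min: "\<And>P. P \<in> M \<Longrightarrow> \<not> volume_entropy P < volume_entropy (G, arev, L)"
      using that by (auto simp: is_arg_min_def)
    obtain P where "P \<in> M" "volume_entropy P = ?min" using attained by blast
    then have "\<not> ?min < volume_entropy (G, arev, L)" using min[of P] by simp
    then show ?thesis using point[OF mem] by linarith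
  qed
  moreover have "\<forall>P\<in>M. ?min \<le> volume_entropy P" using point by (metis prod_cases3)
  ultimately show ?thesis using attained regular by blast
qed

end
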